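(* Let $\iota_X\colon A\to X$ be a map of $\mathcal M$. Let $\rho\colon Z\to A$ and $Z\to X$ be maps of $\mathcal M$ with homotopy pushout $C$, with structure maps $\iota_C\colon A\to C$ and $\chi\colon X\to C$, and suppose that $\chi\circ\iota_X\simeq\iota_C$. Then $$\mathrm{relcat}(\iota_C)\leq\mathrm{relcat}(\iota_X)+1.$$
   Context: Setting. $\mathcal M$ is a closed model category satisfying the Cube axiom: in any homotopy commutative cube whose bottom face is a homotopy pushout and whose four vertical faces are homotopy pullbacks, the top face is a homotopy pushout. (Main example: the category of well-pointed topological spaces, i.e. pointed spaces whose base point inclusion is a closed cofibration.) Objects are taken cofibrant-fibrant (replacing them if necessary), and $\simeq$ denotes homotopy of maps. A homotopy commutative diagram includes a choice of mutually compatible homotopies. The whisker map is the map (unique up to homotopy once homotopies are fixed) induced out of a homotopy pushout, or into a homotopy pullback, by a homotopy commutative square. Ganea construction. For a map $\iota_X\colon A\to X$, put $G_0=A$, $g_0=\iota_X$, $\alpha_0=\mathrm{id}_A$. Given $g_i\colon G_i\to X$, let $F_i$ be the homotopy pullback of $\iota_X\colon A\to X$ and $g_i\colon G_i\to X$, with maps $\eta_i\colon F_i\to A$, $\beta_i\colon F_i\to G_i$; let $G_{i+1}$ be the homotopy pushout of $\eta_i$ and $\beta_i$, with maps $\alpha_{i+1}\colon A\to G_{i+1}$, $\gamma_i\colon G_i\to G_{i+1}$; and let $g_{i+1}\colon G_{i+1}\to X$ be the whisker map induced by $\iota_X$ and $g_i$. Write $G_i=G_i(\iota_X)$. $\mathrm{relcat}(\iota_X)$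 (relative category) is the least $n\ge0$ such that $g_n\colon G_n(\iota_X)\to X$ has a homotopy section $\sigma$ (i.e. $g_n\circ\sigma\simeq\mathrm{id}_X$) with $\sigma\circ\iota_X\simeq\alpha_n$ ($\infty$ if no such $n$ exists). *)

theory Defs
  imports "HOL-Library.Extended_Nat"
begin

section \<open>Categories with three classes of maps\<close>

record ('o, 'a) modcat =
  Obj :: "'o set"
  Arr :: "'a set"
  Dom :: "'a \<Rightarrow> 'o"
  Cod :: "'a \<Rightarrow> 'o"
  Id :: "'o \<Rightarrow> 'a"
  Comp :: "'a \<Rightarrow> 'a \<Rightarrow> 'a" (infixl "\<cdot>\<index>" 70)
  Weq :: "'a set"
  Fib :: "'a set"
  Cof :: "'a set"

definition hom :: "('o, 'a, 'x) modcat_scheme \<Rightarrow> 'o \<Rightarrow> 'o \<Rightarrow> 'a set" where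
  "hom M X Y = {f \<in> Arr M. Dom M f = X \<and> Cod M f = Y}"

text \<open>The opposite category; fibrations and cofibrations are exchanged. Every notion below that
  has a dual is defined once and dualised by applying it to \<open>op_cat M\<close>.\<close>

definition op_cat :: "('o, 'a, 'x) modcat_scheme \<Rightarrow> ('o, 'a) modcat" where
  "op_cat M = \<lparr> Obj = Obj M, Arr = Arr M, Dom = Cod M, Cod = Dom M, Id = Id M,
     Comp = (\<lambda>g f. f \<cdot>\<^bsub>M\<^esub> g), Weq = Weq M, Fib = Cof M, Cof = Fib M \<rparr>"

locale category =
  fixes M :: "('o, 'a, 'x) modcat_scheme" (structure)
  assumes Dom_closed: "f \<in> Arr M \<Longrightarrow> Dom M f \<in> Obj M"
    and Cod_closed: "f \<in> Arr M \<Longrightarrow> Cod M f \<in> Obj M"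
    and Id_closed: "X \<in> Obj M \<Longrightarrow> Id M X \<in> hom M X X"
    and Comp_closed: "f \<in> hom M X Y \<Longrightarrow> g \<in> hom M Y Z \<Longrightarrow> g \<cdot> f \<in> hom M X Z"
    and Comp_assoc: "f \<in> hom M W X \<Longrightarrow> g \<in> hom M X Y \<Longrightarrow> h \<in> hom M Y Z \<Longrightarrow>
      (h \<cdot> g) \<cdot> f = h \<cdot> (g \<cdot> f)"
    and Comp_Id: "f \<in> hom M X Y \<Longrightarrow> f \<cdot> Id M X = f"
    and Id_Comp: "f \<in> hom M X Y \<Longrightarrow> Id M Y \<cdot> f = f"

subsection \<open>Finite limits\<close>

text \<open>A finite diagram is given by its list of objects and its list of arrows, where \<open>(i, j, f)\<close>
  stands for an arrow \<open>f\<close> from the \<open>i\<close>-th to the \<open>j\<close>-th object.\<close>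

definition finite_diagram ::
  "('o, 'a, 'x) modcat_scheme \<Rightarrow> 'o list \<Rightarrow> (nat \<times> nat \<times> 'a) list \<Rightarrow> bool" where
  "finite_diagram M ds es \<longleftrightarrow> set ds \<subseteq> Obj M \<and>
     (\<forall>(i, j, f) \<in> set es. i < length ds \<and> j < length ds \<and> f \<in> hom M (ds ! i) (ds ! j))"

definition is_cone ::
  "('o, 'a, 'x) modcat_scheme \<Rightarrow> 'o list \<Rightarrow> (nat \<times> nat \<times> 'a) list \<Rightarrow> 'o \<Rightarrow> (nat \<Rightarrow> 'a) \<Rightarrow> bool" where
  "is_cone M ds es L l \<longleftrightarrow> L \<in> Obj M \<and>
     (\<forall>i < length ds. l i \<in> hom M L (ds ! i)) \<and>
     (\<forall>(i, j, f) \<in> set es. f \<cdot>\<^bsub>M\<^esub> l i = l j)"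

definition is_limit ::
  "('o, 'a, 'x) modcat_scheme \<Rightarrow> 'o list \<Rightarrow> (nat \<times> nat \<times> 'a) list \<Rightarrow> 'o \<Rightarrow> (nat \<Rightarrow> 'a) \<Rightarrow> bool" where
  "is_limit M ds es L l \<longleftrightarrow> is_cone M ds es L l \<and>
     (\<forall>T t. is_cone M ds es T t \<longrightarrow>
        (\<exists>!u. u \<in> hom M T L \<and> (\<forall>i < length ds. l i \<cdot>\<^bsub>M\<^esub> u = t i)))"

definition has_finite_limits :: "('o, 'a, 'x) modcat_scheme \<Rightarrow> bool" where
  "has_finite_limits M \<longleftrightarrow>
     (\<forall>ds es. finite_diagram M ds es \<longrightarrow> (\<exists>L l. is_limit M ds es L l))"

definition is_terminal :: "('o, 'a, 'x) modcat_scheme \<Rightarrow> 'o \<Rightarrow> bool" where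
  "is_terminal M T \<longleftrightarrow> T \<in> Obj M \<and> (\<forall>X \<in> Obj M. \<exists>!f. f \<in> hom M X T)"

definition is_product ::
  "('o, 'a, 'x) modcat_scheme \<Rightarrow> 'o \<Rightarrow> 'o \<Rightarrow> 'o \<Rightarrow> 'a \<Rightarrow> 'a \<Rightarrow> bool" where
  "is_product M X Y P p q \<longleftrightarrow> p \<in> hom M P X \<and> q \<in> hom M P Y \<and>
     (\<forall>T. \<forall>a \<in> hom M T X. \<forall>b \<in> hom M T Y.
        \<exists>!u. u \<in> hom M T P \<and> p \<cdot>\<^bsub>M\<^esub> u = a \<and> q \<cdot>\<^bsub>M\<^esub> u = b)"

section \<open>Closed model categories\<close>

definition is_retract :: "('o, 'a, 'x) modcat_scheme \<Rightarrow> 'a \<Rightarrow> 'a \<Rightarrow> bool" where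
  "is_retract M f g \<longleftrightarrow> f \<in> Arr M \<and> g \<in> Arr M \<and>
     (\<exists>i r j q. i \<in> hom M (Dom M f) (Dom M g) \<and> r \<in> hom M (Dom M g) (Dom M f) \<and>
        j \<in> hom M (Cod M f) (Cod M g) \<and> q \<in> hom M (Cod M g) (Cod M f) \<and>
        r \<cdot>\<^bsub>M\<^esub> i = Id M (Dom M f) \<and> q \<cdot>\<^bsub>M\<^esub> j = Id M (Cod M f) \<and>
        g \<cdot>\<^bsub>M\<^esub> i = j \<cdot>\<^bsub>M\<^esub> f \<and> f \<cdot>\<^bsub>M\<^esub> r = q \<cdot>\<^bsub>M\<^esub> g)"

definition has_lifting :: "('o, 'a, 'x) modcat_scheme \<Rightarrow> 'a \<Rightarrow> 'a \<Rightarrow> bool" where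
  "has_lifting M i p \<longleftrightarrow>
     (\<forall>a \<in> hom M (Dom M i) (Dom M p). \<forall>b \<in> hom M (Cod M i) (Cod M p).
        p \<cdot>\<^bsub>M\<^esub> a = b \<cdot>\<^bsub>M\<^esub> i \<longrightarrow>
        (\<exists>l \<in> hom M (Cod M i) (Dom M p). l \<cdot>\<^bsub>M\<^esub> i = a \<and> p \<cdot>\<^bsub>M\<^esub> l = b))"

text \<open>Quillen's axioms CM1 to CM5.\<close>

locale closed_model_category = category +
  assumes Weq_Arr: "Weq M \<subseteq> Arr M" and Fib_Arr: "Fib M \<subseteq> Arr M" and Cof_Arr: "Cof M \<subseteq> Arr M"
    and limits: "has_finite_limits M"
    and colimits: "has_finite_limits (op_cat M)"
    and Weq_comp: "f \<in> hom M X Y \<Longrightarrow> g \<in> hom M Y Z \<Longrightarrow> f \<in> Weq M \<Longrightarrow> g \<in> Weq M \<Longrightarrow> g \<cdot> f \<in> Weq M"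
    and Weq_cancel_left:
      "f \<in> hom M X Y \<Longrightarrow> g \<in> hom M Y Z \<Longrightarrow> g \<in> Weq M \<Longrightarrow> g \<cdot> f \<in> Weq M \<Longrightarrow> f \<in> Weq M"
    and Weq_cancel_right:
      "f \<in> hom M X Y \<Longrightarrow> g \<in> hom M Y Z \<Longrightarrow> f \<in> Weq M \<Longrightarrow> g \<cdot> f \<in> Weq M \<Longrightarrow> g \<in> Weq M"
    and Weq_retract: "is_retract M f g \<Longrightarrow> g \<in> Weq M \<Longrightarrow> f \<in> Weq M"
    and Fib_retract: "is_retract M f g \<Longrightarrow> g \<in> Fib M \<Longrightarrow> f \<in> Fib M"
    and Cof_retract: "is_retract M f g \<Longrightarrow> g \<in> Cof M \<Longrightarrow> f \<in> Cof M"
    and lift_trivial_Cof: "i \<in> Cof M \<inter> Weq M \<Longrightarrow> p \<in> Fib M \<Longrightarrow> has_lifting M i p"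
    and lift_trivial_Fib: "i \<in> Cof M \<Longrightarrow> p \<in> Fib M \<inter> Weq M \<Longrightarrow> has_lifting M i p"
    and factor_trivial_Cof: "f \<in> Arr M \<Longrightarrow>
      \<exists>i p. i \<in> Cof M \<inter> Weq M \<and> p \<in> Fib M \<and> Cod M i = Dom M p \<and> f = p \<cdot> i"
    and factor_trivial_Fib: "f \<in> Arr M \<Longrightarrow>
      \<exists>i p. i \<in> Cof M \<and> p \<in> Fib M \<inter> Weq M \<and> Cod M i = Dom M p \<and> f = p \<cdot> i"

definition fibrant :: "('o, 'a, 'x) modcat_scheme \<Rightarrow> 'o \<Rightarrow> bool" where
  "fibrant M X \<longleftrightarrow> X \<in> Obj M \<and> (\<forall>T f. is_terminal M T \<longrightarrow> f \<in> hom M X T \<longrightarrow> f \<in> Fib M)"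

abbreviation cofibrant :: "('o, 'a, 'x) modcat_scheme \<Rightarrow> 'o \<Rightarrow> bool" where
  "cofibrant M X \<equiv> fibrant (op_cat M) X"

definition bifibrant :: "('o, 'a, 'x) modcat_scheme \<Rightarrow> 'o \<Rightarrow> bool" where
  "bifibrant M X \<longleftrightarrow> fibrant M X \<and> cofibrant M X"

section \<open>Homotopies\<close>

record 'a cyl =
  end0 :: 'a
  end1 :: 'a
  proj :: 'a

text \<open>A cylinder object \<open>X + X \<rightarrow> I \<rightarrow> X\<close>, the first map being a cofibration and the second a weak
  equivalence. The object \<open>I\<close> is the domain of the projection.\<close>

definition cylinder :: "('o, 'a, 'x) modcat_scheme \<Rightarrow> 'o \<Rightarrow> 'a cyl \<Rightarrow> bool" where
  "cylinder M X c \<longleftrightarrow> (let I = Dom M (proj c) in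
     proj c \<in> hom M I X \<and> proj c \<in> Weq M \<and> end0 c \<in> hom M X I \<and> end1 c \<in> hom M X I \<and>
     proj c \<cdot>\<^bsub>M\<^esub> end0 c = Id M X \<and> proj c \<cdot>\<^bsub>M\<^esub> end1 c = Id M X \<and>
     (\<exists>S j0 j1 k. is_product (op_cat M) X X S j0 j1 \<and> k \<in> hom M S I \<and>
        k \<cdot>\<^bsub>M\<^esub> j0 = end0 c \<and> k \<cdot>\<^bsub>M\<^esub> j1 = end1 c \<and> k \<in> Cof M))"

text \<open>Dually, \<open>path_object M Y q\<close> means \<open>Y \<rightarrow> P \<rightarrow> Y \<times> Y\<close>, where \<open>proj q : Y \<rightarrow> P\<close> is a weak
  equivalence and the evaluation maps \<open>end0 q, end1 q : P \<rightarrow> Y\<close> form a fibration.\<close>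

abbreviation path_object :: "('o, 'a, 'x) modcat_scheme \<Rightarrow> 'o \<Rightarrow> 'a cyl \<Rightarrow> bool" where
  "path_object M Y q \<equiv> cylinder (op_cat M) Y q"

definition is_homotopy ::
  "('o, 'a, 'x) modcat_scheme \<Rightarrow> 'o \<Rightarrow> 'o \<Rightarrow> 'a cyl \<Rightarrow> 'a \<Rightarrow> 'a \<Rightarrow> 'a \<Rightarrow> bool" where
  "is_homotopy M X Y c h f g \<longleftrightarrow> f \<in> hom M X Y \<and> g \<in> hom M X Y \<and> cylinder M X c \<and>
     h \<in> hom M (Dom M (proj c)) Y \<and> h \<cdot>\<^bsub>M\<^esub> end0 c = f \<and> h \<cdot>\<^bsub>M\<^esub> end1 c = g"

definition homotopic :: "('o, 'a, 'x) modcat_scheme \<Rightarrow> 'a \<Rightarrow> 'a \<Rightarrow> bool" where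
  "homotopic M f g \<longleftrightarrow> (\<exists>X Y c h. is_homotopy M X Y c h f g)"

text \<open>Quillen's correspondence between a left homotopy \<open>h : I \<rightarrow> Y\<close> and a right homotopy
  \<open>k : W \<rightarrow> P\<close> with the same end maps: both are restrictions of one double homotopy \<open>I \<rightarrow> P\<close>
  which is stationary on the two remaining sides.\<close>

definition corresponding ::
  "('o, 'a, 'x) modcat_scheme \<Rightarrow> 'a cyl \<Rightarrow> 'a cyl \<Rightarrow> 'a \<Rightarrow> 'a \<Rightarrow> bool" where
  "corresponding M c q h k \<longleftrightarrow>
     (\<exists>K \<in> hom M (Dom M (proj c)) (Cod M (proj q)).
        K \<cdot>\<^bsub>M\<^esub> end0 c = k \<and> end0 q \<cdot>\<^bsub>M\<^esub> K = h \<and>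
        K \<cdot>\<^bsub>M\<^esub> end1 c = proj q \<cdot>\<^bsub>M\<^esub> (h \<cdot>\<^bsub>M\<^esub> end1 c) \<and>
        end1 q \<cdot>\<^bsub>M\<^esub> K = (h \<cdot>\<^bsub>M\<^esub> end1 c) \<cdot>\<^bsub>M\<^esub> proj c)"

section \<open>Homotopy pushouts and homotopy pullbacks\<close>

text \<open>A homotopy commutative square of cofibrant-fibrant objects, together with its homotopy
  \<open>h\<close> from \<open>r \<cdot> u\<close> to \<open>s \<cdot> v\<close>:

    \<open>u : W \<rightarrow> U\<close>,  \<open>v : W \<rightarrow> V\<close>,  \<open>r : U \<rightarrow> Y\<close>,  \<open>s : V \<rightarrow> Y\<close>.\<close>

definition hsquare ::
  "('o, 'a, 'x) modcat_scheme \<Rightarrow> 'a \<Rightarrow> 'a \<Rightarrow> 'a \<Rightarrow> 'a \<Rightarrow> 'a cyl \<Rightarrow> 'a \<Rightarrow> bool" where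
  "hsquare M u v r s c h \<longleftrightarrow>
     (\<exists>W U V Y. bifibrant M W \<and> bifibrant M U \<and> bifibrant M V \<and> bifibrant M Y \<and>
        u \<in> hom M W U \<and> v \<in> hom M W V \<and> r \<in> hom M U Y \<and> s \<in> hom M V Y \<and>
        is_homotopy M W Y c h (r \<cdot>\<^bsub>M\<^esub> u) (s \<cdot>\<^bsub>M\<^esub> v))"

text \<open>The double mapping cylinder of \<open>U \<leftarrow> W \<rightarrow> V\<close>: the colimit \<open>E\<close> of
  \<open>U \<leftarrow> W \<rightarrow> I \<leftarrow> W \<rightarrow> V\<close>, with colimit maps \<open>a\<close>, \<open>e\<close>, \<open>b\<close> on \<open>U\<close>, \<open>I\<close>, \<open>V\<close>. In \<open>op_cat M\<close> this
  is the double mapping path object \<open>U \<times>\<^sub>Y P \<times>\<^sub>Y V\<close> of \<open>U \<rightarrow> Y \<leftarrow> V\<close>.\<close>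

definition double_mapping_cylinder ::
  "('o, 'a, 'x) modcat_scheme \<Rightarrow> 'a \<Rightarrow> 'a \<Rightarrow> 'a cyl \<Rightarrow> 'o \<Rightarrow> 'a \<Rightarrow> 'a \<Rightarrow> 'a \<Rightarrow> bool" where
  "double_mapping_cylinder M u v c E a e b \<longleftrightarrow>
     a \<in> hom M (Cod M u) E \<and> e \<in> hom M (Dom M (proj c)) E \<and> b \<in> hom M (Cod M v) E \<and>
     e \<cdot>\<^bsub>M\<^esub> end0 c = a \<cdot>\<^bsub>M\<^esub> u \<and> e \<cdot>\<^bsub>M\<^esub> end1 c = b \<cdot>\<^bsub>M\<^esub> v \<and>
     (\<forall>T. \<forall>a' \<in> hom M (Cod M u) T. \<forall>e' \<in> hom M (Dom M (proj c)) T. \<forall>b' \<in> hom M (Cod M v) T.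
        e' \<cdot>\<^bsub>M\<^esub> end0 c = a' \<cdot>\<^bsub>M\<^esub> u \<longrightarrow> e' \<cdot>\<^bsub>M\<^esub> end1 c = b' \<cdot>\<^bsub>M\<^esub> v \<longrightarrow>
        (\<exists>!w. w \<in> hom M E T \<and> w \<cdot>\<^bsub>M\<^esub> a = a' \<and> w \<cdot>\<^bsub>M\<^esub> e = e' \<and> w \<cdot>\<^bsub>M\<^esub> b = b'))"

abbreviation double_mapping_path ::
  "('o, 'a, 'x) modcat_scheme \<Rightarrow> 'a \<Rightarrow> 'a \<Rightarrow> 'a cyl \<Rightarrow> 'o \<Rightarrow> 'a \<Rightarrow> 'a \<Rightarrow> 'a \<Rightarrow> bool" where
  "double_mapping_path M r s q E a e b \<equiv> double_mapping_cylinder (op_cat M) r s q E a e b"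

definition hpushout ::
  "('o, 'a, 'x) modcat_scheme \<Rightarrow> 'a \<Rightarrow> 'a \<Rightarrow> 'a \<Rightarrow> 'a \<Rightarrow> 'a cyl \<Rightarrow> 'a \<Rightarrow> bool" where
  "hpushout M u v r s c h \<longleftrightarrow> hsquare M u v r s c h \<and>
     (\<exists>E a e b w. double_mapping_cylinder M u v c E a e b \<and>
        w \<in> hom M E (Cod M r) \<and> w \<cdot>\<^bsub>M\<^esub> a = r \<and> w \<cdot>\<^bsub>M\<^esub> e = h \<and> w \<cdot>\<^bsub>M\<^esub> b = s \<and> w \<in> Weq M)"

definition hpullback ::
  "('o, 'a, 'x) modcat_scheme \<Rightarrow> 'a \<Rightarrow> 'a \<Rightarrow> 'a \<Rightarrow> 'a \<Rightarrow> 'a cyl \<Rightarrow> 'a \<Rightarrow> bool" where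
  "hpullback M u v r s c h \<longleftrightarrow> hsquare M u v r s c h \<and>
     (\<exists>q k. path_object M (Cod M r) q \<and> corresponding M c q h k \<and>
       (\<exists>E a e b w. double_mapping_path M r s q E a e b \<and>
          w \<in> hom M (Dom M u) E \<and> a \<cdot>\<^bsub>M\<^esub> w = u \<and> e \<cdot>\<^bsub>M\<^esub> w = k \<and> b \<cdot>\<^bsub>M\<^esub> w = v \<and> w \<in> Weq M))"

text \<open>\<open>w\<close> is a whisker map, out of the homotopy pushout \<open>(u, v, r, s, h)\<close>, induced by the homotopy
  commutative square \<open>(u, v, r', s', h')\<close>: it corresponds, up to homotopy and through the
  comparison equivalence \<open>x\<close>, to the map \<open>y\<close> which \<open>r'\<close>, \<open>h'\<close>, \<open>s'\<close> define on the double mapping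
  cylinder. Using the same cylinder for \<open>h\<close> and \<open>h'\<close> is no restriction, since a homotopy can be
  transported from one cylinder to another.\<close>

definition whisker ::
  "('o, 'a, 'x) modcat_scheme \<Rightarrow> 'a \<Rightarrow> 'a \<Rightarrow> 'a \<Rightarrow> 'a \<Rightarrow> 'a cyl \<Rightarrow> 'a \<Rightarrow> 'a \<Rightarrow> 'a \<Rightarrow> 'a \<Rightarrow> 'a \<Rightarrow> bool"
where
  "whisker M u v r s c h r' s' h' w \<longleftrightarrow>
     hpushout M u v r s c h \<and> hsquare M u v r' s' c h' \<and> w \<in> hom M (Cod M r) (Cod M r') \<and>
     (\<exists>E a e b x y. double_mapping_cylinder M u v c E a e b \<and>
        x \<in> hom M E (Cod M r) \<and> x \<cdot>\<^bsub>M\<^esub> a = r \<and> x \<cdot>\<^bsub>M\<^esub> e = h \<and> x \<cdot>\<^bsub>M\<^esub> b = s \<and>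
        y \<in> hom M E (Cod M r') \<and> y \<cdot>\<^bsub>M\<^esub> a = r' \<and> y \<cdot>\<^bsub>M\<^esub> e = h' \<and> y \<cdot>\<^bsub>M\<^esub> b = s' \<and>
        homotopic M (w \<cdot>\<^bsub>M\<^esub> x) y)"

section \<open>The Cube axiom\<close>

text \<open>A map of cylinders over \<open>u\<close>; composing a homotopy with it gives the homotopy precomposed
  with \<open>u\<close>.\<close>

definition cyl_map ::
  "('o, 'a, 'x) modcat_scheme \<Rightarrow> 'a cyl \<Rightarrow> 'a cyl \<Rightarrow> 'a \<Rightarrow> 'a \<Rightarrow> bool" where
  "cyl_map M c d u t \<longleftrightarrow> t \<in> hom M (Dom M (proj c)) (Dom M (proj d)) \<and>
     t \<cdot>\<^bsub>M\<^esub> end0 c = end0 d \<cdot>\<^bsub>M\<^esub> u \<and> t \<cdot>\<^bsub>M\<^esub> end1 c = end1 d \<cdot>\<^bsub>M\<^esub> u \<and>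
     proj d \<cdot>\<^bsub>M\<^esub> t = u \<cdot>\<^bsub>M\<^esub> proj c"

text \<open>Two chains \<open>x\<^sub>1, x\<^sub>2, x\<^sub>3\<close> and \<open>y\<^sub>1, y\<^sub>2, y\<^sub>3\<close> of homotopies with common first and last map have
  homotopic composites: the hexagon of the six homotopies extends along some \<open>D\<close> which contains the
  six cylinders glued to a hexagon and is weakly equivalent to the source \<open>W\<close>. (The map from the
  hexagon to \<open>D\<close> can then be replaced by a cofibration.)\<close>

definition hexagon_filled ::
  "('o, 'a, 'x) modcat_scheme \<Rightarrow> 'a cyl \<Rightarrow> 'a \<Rightarrow> 'a \<Rightarrow> 'a \<Rightarrow> 'a \<Rightarrow> 'a \<Rightarrow> 'a \<Rightarrow> bool" where
  "hexagon_filled M c x1 x2 x3 y1 y2 y3 \<longleftrightarrow>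
     (let I = Dom M (proj c) in
      \<exists>D z F j1 j2 j3 k1 k2 k3. z \<in> hom M D (Cod M (proj c)) \<and> z \<in> Weq M \<and> F \<in> hom M D (Cod M x1) \<and>
        {j1, j2, j3, k1, k2, k3} \<subseteq> hom M I D \<and> (\<forall>j \<in> {j1, j2, j3, k1, k2, k3}. z \<cdot>\<^bsub>M\<^esub> j = proj c) \<and>
        j1 \<cdot>\<^bsub>M\<^esub> end0 c = k1 \<cdot>\<^bsub>M\<^esub> end0 c \<and> j3 \<cdot>\<^bsub>M\<^esub> end1 c = k3 \<cdot>\<^bsub>M\<^esub> end1 c \<and>
        j1 \<cdot>\<^bsub>M\<^esub> end1 c = j2 \<cdot>\<^bsub>M\<^esub> end0 c \<and> j2 \<cdot>\<^bsub>M\<^esub> end1 c = j3 \<cdot>\<^bsub>M\<^esub> end0 c \<and>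
        k1 \<cdot>\<^bsub>M\<^esub> end1 c = k2 \<cdot>\<^bsub>M\<^esub> end0 c \<and> k2 \<cdot>\<^bsub>M\<^esub> end1 c = k3 \<cdot>\<^bsub>M\<^esub> end0 c \<and>
        F \<cdot>\<^bsub>M\<^esub> j1 = x1 \<and> F \<cdot>\<^bsub>M\<^esub> j2 = x2 \<and> F \<cdot>\<^bsub>M\<^esub> j3 = x3 \<and>
        F \<cdot>\<^bsub>M\<^esub> k1 = y1 \<and> F \<cdot>\<^bsub>M\<^esub> k2 = y2 \<and> F \<cdot>\<^bsub>M\<^esub> k3 = y3)"

text \<open>The cube has top vertices \<open>A, B, C, D\<close>, bottom vertices \<open>A', B', C', D'\<close>, top maps
  \<open>ab, ac, bd, cd\<close>, bottom maps \<open>ab', ac', bd', cd'\<close> and vertical maps \<open>a, b, c, d\<close>. The homotopies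
  on its faces are
    top \<open>ht : bd \<cdot> ab \<simeq> cd \<cdot> ac\<close>,  bottom \<open>hb : bd' \<cdot> ab' \<simeq> cd' \<cdot> ac'\<close>,
    \<open>h1 : b \<cdot> ab \<simeq> ab' \<cdot> a\<close>,  \<open>h2 : c \<cdot> ac \<simeq> ac' \<cdot> a\<close>,  \<open>h3 : d \<cdot> bd \<simeq> bd' \<cdot> b\<close>,
    \<open>h4 : d \<cdot> cd \<simeq> cd' \<cdot> c\<close>.
  They are compatible if the two chains of homotopies
    \<open>d \<cdot> bd \<cdot> ab \<simeq> d \<cdot> cd \<cdot> ac \<simeq> cd' \<cdot> c \<cdot> ac \<simeq> cd' \<cdot> ac' \<cdot> a\<close> and
    \<open>d \<cdot> bd \<cdot> ab \<simeq> bd' \<cdot> b \<cdot> ab \<simeq> bd' \<cdot> ab' \<cdot> a \<simeq> cd' \<cdot> ac' \<cdot> a\<close>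
  have homotopic composites.\<close>

definition hcube ::
  "('o, 'a, 'x) modcat_scheme \<Rightarrow> 'a \<Rightarrow> 'a \<Rightarrow> 'a \<Rightarrow> 'a \<Rightarrow> 'a \<Rightarrow> 'a \<Rightarrow> 'a \<Rightarrow> 'a \<Rightarrow> 'a \<Rightarrow> 'a \<Rightarrow> 'a \<Rightarrow> 'a \<Rightarrow>
   'a cyl \<Rightarrow> 'a cyl \<Rightarrow> 'a cyl \<Rightarrow> 'a cyl \<Rightarrow> 'a \<Rightarrow> 'a \<Rightarrow> 'a \<Rightarrow> 'a \<Rightarrow> 'a \<Rightarrow> 'a \<Rightarrow> bool" where
  "hcube M ab ac bd cd ab' ac' bd' cd' a b c d cA cB cC cA' ht hb h1 h2 h3 h4 \<longleftrightarrow>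
     hsquare M ab ac bd cd cA ht \<and> hsquare M ab' ac' bd' cd' cA' hb \<and>
     hsquare M ab a b ab' cA h1 \<and> hsquare M ac a c ac' cA h2 \<and>
     hsquare M bd b d bd' cB h3 \<and> hsquare M cd c d cd' cC h4 \<and>
     (\<exists>tB tC tA. cyl_map M cA cB ab tB \<and> cyl_map M cA cC ac tC \<and> cyl_map M cA cA' a tA \<and>
        hexagon_filled M cA
          (d \<cdot>\<^bsub>M\<^esub> ht) (h4 \<cdot>\<^bsub>M\<^esub> tC) (cd' \<cdot>\<^bsub>M\<^esub> h2)
          (h3 \<cdot>\<^bsub>M\<^esub> tB) (bd' \<cdot>\<^bsub>M\<^esub> h1) (hb \<cdot>\<^bsub>M\<^esub> tA))"

definition cube_axiom :: "('o, 'a, 'x) modcat_scheme \<Rightarrow> bool" where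
  "cube_axiom M \<longleftrightarrow>
     (\<forall>ab ac bd cd ab' ac' bd' cd' a b c d cA cB cC cA' ht hb h1 h2 h3 h4.
        hcube M ab ac bd cd ab' ac' bd' cd' a b c d cA cB cC cA' ht hb h1 h2 h3 h4 \<longrightarrow>
        hpushout M ab' ac' bd' cd' cA' hb \<longrightarrow>
        hpullback M ab a b ab' cA h1 \<longrightarrow> hpullback M ac a c ac' cA h2 \<longrightarrow>
        hpullback M bd b d bd' cB h3 \<longrightarrow> hpullback M cd c d cd' cC h4 \<longrightarrow>
        hpushout M ab ac bd cd cA ht)"

section \<open>The Ganea construction and relative category\<close>

text \<open>\<open>ganea M \<iota> n g \<alpha>\<close>: for some choice of homotopy pullbacks and pushouts, \<open>g : G\<^sub>n \<rightarrow> X\<close> and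
  \<open>\<alpha> : A \<rightarrow> G\<^sub>n\<close> are the maps of the \<open>n\<close>-th stage of the Ganea construction of \<open>\<iota> : A \<rightarrow> X\<close>. Different
  choices give homotopy equivalent stages, compatibly with \<open>g\<close> and \<open>\<alpha>\<close>.\<close>

inductive ganea :: "('o, 'a, 'x) modcat_scheme \<Rightarrow> 'a \<Rightarrow> nat \<Rightarrow> 'a \<Rightarrow> 'a \<Rightarrow> bool"
  for M :: "('o, 'a, 'x) modcat_scheme" and \<iota> :: 'a where
  ganea_0: "ganea M \<iota> 0 \<iota> (Id M (Dom M \<iota>))"
| ganea_Suc: "ganea M \<iota> i g \<alpha> \<Longrightarrow> hpullback M \<eta> \<beta> \<iota> g c h \<Longrightarrow> hpushout M \<eta> \<beta> \<alpha>' \<gamma> c l \<Longrightarrow>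
    whisker M \<eta> \<beta> \<alpha>' \<gamma> c l \<iota> g h g' \<Longrightarrow> ganea M \<iota> (Suc i) g' \<alpha>'"

definition relcat_le :: "('o, 'a, 'x) modcat_scheme \<Rightarrow> 'a \<Rightarrow> nat \<Rightarrow> bool" where
  "relcat_le M \<iota> n \<longleftrightarrow>
     (\<exists>g \<alpha> \<sigma>. ganea M \<iota> n g \<alpha> \<and> \<sigma> \<in> hom M (Cod M \<iota>) (Dom M g) \<and>
        homotopic M (g \<cdot>\<^bsub>M\<^esub> \<sigma>) (Id M (Cod M \<iota>)) \<and> homotopic M (\<sigma> \<cdot>\<^bsub>M\<^esub> \<iota>) \<alpha>)"

text \<open>The infimum of the empty set is \<open>\<infinity>\<close>.\<close>

definition relcat :: "('o, 'a, 'x) modcat_scheme \<Rightarrow> 'a \<Rightarrow> enat" where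
  "relcat M \<iota> = Inf (enat ` {n. relcat_le M \<iota> n})"

end

theory Submission
  imports Defs
begin

text \<open>
  Let \<open>n\<close> be the relative category of \<open>\<iota>X\<close>, with section \<open>\<sigma>\<close> of \<open>G\<^sub>n(\<iota>X) \<rightarrow> X\<close>. The Ganea
  construction is natural, so \<open>\<chi>\<close> is covered by a map \<open>G\<^sub>n(\<iota>X) \<rightarrow> G\<^sub>n(\<iota>C)\<close>, and composing it with \<open>\<sigma>\<close>
  gives a lift of \<open>\<chi> : X \<rightarrow> C\<close> through \<open>G\<^sub>n(\<iota>C)\<close>. The map \<open>\<iota>C : A \<rightarrow> C\<close> lifts through itself by the
  identity of \<open>A\<close>. These two lifts and the homotopy of the pushout square define on \<open>Z\<close> a map into
  the homotopy pullback \<open>F\<^sub>n\<close> of \<open>\<iota>C\<close> and \<open>G\<^sub>n(\<iota>C) \<rightarrow> C\<close>, and therefore a map from \<open>C\<close>, the homotopy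
  pushout of \<open>A\<close> and \<open>X\<close> under \<open>Z\<close>, to \<open>G\<^sub>n\<^sub>+\<^sub>1(\<iota>C)\<close>, the homotopy pushout of \<open>A\<close> and \<open>G\<^sub>n(\<iota>C)\<close> under
  \<open>F\<^sub>n\<close>. It is a homotopy section, and its restriction to \<open>A\<close> is \<open>\<alpha>\<^sub>n\<^sub>+\<^sub>1\<close> up to homotopy.

  Naturality of the Ganea construction is an instance of the same argument: a map on a homotopy
  pushout lifts to a join as soon as its restrictions to the two corners lift to the factors of
  the join. That is \<open>map_to_join\<close>; it is applied once per stage in \<open>ganea_map\<close> and once more in
  \<open>relcat_le_Suc_hpushout\<close>.

  The delicate point is the coherence of the homotopies: whether the composite \<open>C \<rightarrow> G\<^sub>n\<^sub>+\<^sub>1(\<iota>C) \<rightarrow> C\<close>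
  is homotopic to the identity depends on the homotopy that it induces on \<open>Z\<close>. The stages for \<open>\<iota>C\<close>
  may be chosen, and a suitable choice turns these homotopies into equalities. In
  \<open>hpullback_exists\<close> the homotopy pullback and a cylinder on it are built so that every homotopy
  on a cofibrant object is a strict restriction of the universal one; in \<open>hpushout_exists\<close> the
  homotopy pushout is built so that whisker maps satisfy their equations strictly. What remains is
  the standard homotopy theory of maps from cofibrant to fibrant objects, derived from lifting
  properties.
\<close>

section \<open>Duality\<close>

lemma op_cat_simps [simp]:
  "Obj (op_cat M) = Obj M" "Arr (op_cat M) = Arr M" "Dom (op_cat M) = Cod M"
  "Cod (op_cat M) = Dom M" "Id (op_cat M) = Id M" "Comp (op_cat M) g f = f \<cdot>\<^bsub>M\<^esub> g"
  "Weq (op_cat M) = Weq M" "Fib (op_cat M) = Cof M" "Cof (op_cat M) = Fib M"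
  by (simp_all add: op_cat_def)

lemma hom_op_cat [simp]: "hom (op_cat M) X Y = hom M Y X"
  by (auto simp: hom_def)

lemma has_lifting_op_cat [simp]: "has_lifting (op_cat M) p i \<longleftrightarrow> has_lifting M i p"
proof
  assume L: "has_lifting (op_cat M) p i"
  show "has_lifting M i p"
    unfolding has_lifting_def
  proof (intro ballI impI)
    fix a b
    assume "a \<in> hom M (Dom M i) (Dom M p)" "b \<in> hom M (Cod M i) (Cod M p)"
      "p \<cdot>\<^bsub>M\<^esub> a = b \<cdot>\<^bsub>M\<^esub> i"
    then show "\<exists>l \<in> hom M (Cod M i) (Dom M p). l \<cdot>\<^bsub>M\<^esub> i = a \<and> p \<cdot>\<^bsub>M\<^esub> l = b"
      using L[unfolded has_lifting_def, rule_format, of b a] by auto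
  qed
next
  assume L: "has_lifting M i p"
  show "has_lifting (op_cat M) p i"
    unfolding has_lifting_def
  proof (intro ballI impI)
    fix b a
    assume "b \<in> hom (op_cat M) (Dom (op_cat M) p) (Dom (op_cat M) i)"
      "a \<in> hom (op_cat M) (Cod (op_cat M) p) (Cod (op_cat M) i)"
      "Comp (op_cat M) i b = Comp (op_cat M) a p"
    then show "\<exists>l \<in> hom (op_cat M) (Cod (op_cat M) p) (Dom (op_cat M) i).
        Comp (op_cat M) l p = b \<and> Comp (op_cat M) i l = a"
      using L[unfolded has_lifting_def, rule_format, of a b] by auto
  qed
qed

lemma is_retract_op_catI:
  assumes "is_retract (op_cat M) f g"
  shows "is_retract M f g"
proof -
  from assms obtain i r j q where "f \<in> Arr M" "g \<in> Arr M"
    "i \<in> hom M (Cod M g) (Cod M f)" "r \<in> hom M (Cod M f) (Cod M g)"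
    "j \<in> hom M (Dom M g) (Dom M f)" "q \<in> hom M (Dom M f) (Dom M g)"
    "i \<cdot>\<^bsub>M\<^esub> r = Id M (Cod M f)" "j \<cdot>\<^bsub>M\<^esub> q = Id M (Dom M f)"
    "i \<cdot>\<^bsub>M\<^esub> g = f \<cdot>\<^bsub>M\<^esub> j" "r \<cdot>\<^bsub>M\<^esub> f = g \<cdot>\<^bsub>M\<^esub> q"
    unfolding is_retract_def by auto
  then show ?thesis
    unfolding is_retract_def
    by (intro conjI exI[of _ q] exI[of _ j] exI[of _ r] exI[of _ i]) simp_all
qed

text \<open>Dualising twice only forgets the record extension, which no notion refers to. With these
  rules every lemma about fibrations or path objects is its counterpart about cofibrations or
  cylinders, read in \<open>op_cat M\<close>.\<close>

lemma has_finite_limits_op_op [simp]: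
  "has_finite_limits (op_cat (op_cat M)) = has_finite_limits M"
  by (simp add: has_finite_limits_def finite_diagram_def is_limit_def is_cone_def)

lemma fibrant_op_op [simp]: "fibrant (op_cat (op_cat M)) X = fibrant M X"
  by (simp add: fibrant_def is_terminal_def)

lemma cylinder_op_op [simp]: "cylinder (op_cat (op_cat M)) X c = cylinder M X c"
  by (simp add: cylinder_def is_product_def)

lemma closed_model_category_op_cat:
  assumes "closed_model_category M"
  shows "closed_model_category (op_cat M)"
proof -
  interpret closed_model_category M by (fact assms)
  show ?thesis
  proof
    fix f
    assume f: "f \<in> Arr (op_cat M)"
    show "\<exists>i p. i \<in> Cof (op_cat M) \<inter> Weq (op_cat M) \<and> p \<in> Fib (op_cat M) \<and>
        Cod (op_cat M) i = Dom (op_cat M) p \<and> f = Comp (op_cat M) p i"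
      using factor_trivial_Fib[of f] f by simp metis
    show "\<exists>i p. i \<in> Cof (op_cat M) \<and> p \<in> Fib (op_cat M) \<inter> Weq (op_cat M) \<and>
        Cod (op_cat M) i = Dom (op_cat M) p \<and> f = Comp (op_cat M) p i"
      using factor_trivial_Cof[of f] f by simp metis
  qed (use Dom_closed Cod_closed Id_closed Comp_closed Comp_assoc[symmetric] Comp_Id Id_Comp
      Weq_Arr Fib_Arr Cof_Arr limits colimits Weq_comp Weq_cancel_left Weq_cancel_right
      Weq_retract Fib_retract Cof_retract lift_trivial_Cof lift_trivial_Fib
      in \<open>auto dest: is_retract_op_catI\<close>)
qed

section \<open>Lifting properties\<close>

context category
begin

text \<open>Domains and codomains are kept as equations between objects, so that the simplifier can
  discharge all composability conditions and normalise composites by associating to the right.\<close>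

lemma comp_simps [simp]:
  assumes "f \<in> Arr M" and "g \<in> Arr M" and "Cod M f = Dom M g"
  shows "g \<cdot> f \<in> Arr M" and "Dom M (g \<cdot> f) = Dom M f" and "Cod M (g \<cdot> f) = Cod M g"
  using Comp_closed[of f "Dom M f" "Cod M f" g "Cod M g"] assms by (auto simp: hom_def)

lemma Id_simps [simp]:
  assumes "X \<in> Obj M"
  shows "Id M X \<in> Arr M" and "Dom M (Id M X) = X" and "Cod M (Id M X) = X"
  using Id_closed[OF assms] by (auto simp: hom_def)

lemma comp_assoc [simp]:
  assumes "f \<in> Arr M" and "g \<in> Arr M" and "h \<in> Arr M"
    and "Cod M f = Dom M g" and "Cod M g = Dom M h"
  shows "(h \<cdot> g) \<cdot> f = h \<cdot> (g \<cdot> f)"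
  by (rule Comp_assoc[of f "Dom M f" "Dom M g" g "Dom M h" h "Cod M h"])
    (use assms in \<open>auto simp: hom_def\<close>)

lemma comp_Id [simp]: "f \<in> Arr M \<Longrightarrow> Dom M f = X \<Longrightarrow> f \<cdot> Id M X = f"
  using Comp_Id[of f X "Cod M f"] by (simp add: hom_def)

lemma Id_comp [simp]: "f \<in> Arr M \<Longrightarrow> Cod M f = Y \<Longrightarrow> Id M Y \<cdot> f = f"
  using Id_Comp[of f "Dom M f" Y] by (simp add: hom_def)

lemma hom_Obj:
  assumes "f \<in> hom M X Y"
  shows "X \<in> Obj M" and "Y \<in> Obj M"
  using assms Dom_closed Cod_closed by (auto simp: hom_def)

text \<open>A rewrite rule \<open>p \<cdot> a = q\<close> no longer matches inside a composite associated to the right;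
  this is the form that does.\<close>

lemma reassoc:
  assumes "p \<cdot> a = q" and "a \<in> Arr M" and "p \<in> Arr M" and "Cod M a = Dom M p"
    and "f \<in> Arr M" and "Cod M f = Dom M a"
  shows "p \<cdot> (a \<cdot> f) = q \<cdot> f"
  using assms comp_assoc[of f a p] by simp

end

context closed_model_category
begin

lemma Id_Weq: "X \<in> Obj M \<Longrightarrow> Id M X \<in> Weq M"
proof -
  assume X: "X \<in> Obj M"
  obtain i p where i: "i \<in> Cof M \<inter> Weq M" and p: "p \<in> Fib M" "Cod M i = Dom M p" "p \<cdot> i = Id M X"
    using factor_trivial_Cof[of "Id M X"] X by (auto dest: sym)
  have a: "i \<in> Arr M" "p \<in> Arr M" using i p Cof_Arr Fib_Arr by auto
  have "Dom M i = X" using p(2,3) a X comp_simps(2)[of i p] by simp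
  then show ?thesis
    using Weq_cancel_left[of "Id M X" X X i "Cod M i"] a X i by (auto simp: hom_def)
qed

lemma has_liftingD:
  assumes "has_lifting M i p" and "i \<in> hom M X Y" and "p \<in> hom M A B"
    and "a \<in> hom M X A" and "b \<in> hom M Y B" and "p \<cdot> a = b \<cdot> i"
  shows "\<exists>l \<in> hom M Y A. l \<cdot> i = a \<and> p \<cdot> l = b"
  using assms unfolding has_lifting_def by (auto simp: hom_def)

text \<open>The retract argument: a lift of \<open>i\<close> against \<open>p\<close> exhibits \<open>p\<close> as a retract of its second
  factor.\<close>

lemma retract_of_factor:
  assumes p: "p \<in> Arr M" and a: "i \<in> Arr M" "f \<in> Arr M" and f: "Cod M i = Dom M f" "f \<cdot> i = p"
    and lift: "has_lifting M i p"
  shows "is_retract M p f"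
proof -
  have d: "Dom M i = Dom M p" "Cod M f = Cod M p" using a f comp_simps(2,3)[of i f] by simp_all
  have O: "Dom M p \<in> Obj M" "Cod M p \<in> Obj M" using p Dom_closed Cod_closed by auto
  obtain l where l: "l \<in> hom M (Cod M i) (Dom M p)" "l \<cdot> i = Id M (Dom M p)" "p \<cdot> l = f"
    using has_liftingD[OF lift, of "Dom M p" "Cod M i" "Dom M p" "Cod M p" "Id M (Dom M p)" f]
      a d O f p by (auto simp: hom_def)
  show ?thesis
    unfolding is_retract_def
    by (intro conjI exI[of _ i] exI[of _ l] exI[of _ "Id M (Cod M p)"])
      (use a d O f p l in \<open>auto simp: hom_def\<close>)
qed

lemma Fib_if_lifting:
  assumes p: "p \<in> Arr M" and lift: "\<And>i. i \<in> Cof M \<inter> Weq M \<Longrightarrow> has_lifting M i p"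
  shows "p \<in> Fib M"
proof -
  obtain i f where i: "i \<in> Cof M \<inter> Weq M" and f: "f \<in> Fib M" "Cod M i = Dom M f" "f \<cdot> i = p"
    using factor_trivial_Cof[OF p] by metis
  have "is_retract M p f"
    using retract_of_factor[OF p _ _ f(2,3) lift[OF i]] i f(1) Cof_Arr Fib_Arr by blast
  then show ?thesis using Fib_retract f by blast
qed

lemma trivial_Fib_if_lifting:
  assumes p: "p \<in> Arr M" and lift: "\<And>i. i \<in> Cof M \<Longrightarrow> has_lifting M i p"
  shows "p \<in> Fib M \<inter> Weq M"
proof -
  obtain i f where i: "i \<in> Cof M" and f: "f \<in> Fib M \<inter> Weq M" "Cod M i = Dom M f" "f \<cdot> i = p"
    using factor_trivial_Fib[OF p] by metis
  have "is_retract M p f"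
    using retract_of_factor[OF p _ _ f(2,3) lift[OF i]] i f(1) Cof_Arr Fib_Arr by blast
  then show ?thesis using Fib_retract Weq_retract f by blast
qed

lemma Cof_if_lifting:
  assumes "i \<in> Arr M" and "\<And>p. p \<in> Fib M \<inter> Weq M \<Longrightarrow> has_lifting M i p"
  shows "i \<in> Cof M"
  using closed_model_category.Fib_if_lifting[OF closed_model_category_op_cat
      [OF closed_model_category_axioms], of i] assms by auto

lemma trivial_Fib_lift:
  assumes "p \<in> Fib M \<inter> Weq M" and "i \<in> Cof M" and "i \<in> hom M X Y" and "p \<in> hom M A B"
    and "a \<in> hom M X A" and "b \<in> hom M Y B" and "p \<cdot> a = b \<cdot> i"
  shows "\<exists>l \<in> hom M Y A. l \<cdot> i = a \<and> p \<cdot> l = b"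
  using has_liftingD[OF lift_trivial_Fib] assms by blast

lemma trivial_Cof_lift:
  assumes "i \<in> Cof M \<inter> Weq M" and "p \<in> Fib M" and "i \<in> hom M X Y" and "p \<in> hom M A B"
    and "a \<in> hom M X A" and "b \<in> hom M Y B" and "p \<cdot> a = b \<cdot> i"
  shows "\<exists>l \<in> hom M Y A. l \<cdot> i = a \<and> p \<cdot> l = b"
  using has_liftingD[OF lift_trivial_Cof] assms by blast

lemma Id_trivial_Fib: "X \<in> Obj M \<Longrightarrow> Id M X \<in> Fib M \<inter> Weq M"
  by (rule trivial_Fib_if_lifting) (auto simp: has_lifting_def hom_def)


section \<open>Fibrant and cofibrant objects\<close>

lemma terminal_exists: obtains T where "is_terminal M T"
proof -
  have "finite_diagram M [] []" by (simp add: finite_diagram_def)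
  then obtain L l where "is_limit M [] [] L l"
    using limits unfolding has_finite_limits_def by blast
  then have "is_terminal M L"
    unfolding is_limit_def is_cone_def is_terminal_def by simp
  then show ?thesis by (rule that)
qed

lemma terminal_map: "is_terminal M T \<Longrightarrow> X \<in> Obj M \<Longrightarrow> \<exists>t. t \<in> hom M X T"
  unfolding is_terminal_def by blast

lemma terminal_unique: "is_terminal M T \<Longrightarrow> s \<in> hom M X T \<Longrightarrow> t \<in> hom M X T \<Longrightarrow> s = t"
  unfolding is_terminal_def using hom_Obj(1) by metis

text \<open>Both directions come from the uniqueness of maps to a terminal object: the square of a
  lifting problem against \<open>X \<rightarrow> T\<close> commutes for free. In this form, fibrancy can be checked and
  used without naming a terminal object.\<close>

lemma fibrant_iff_extension:
  "fibrant M X \<longleftrightarrow> X \<in> Obj M \<and> (\<forall>i \<in> Cof M \<inter> Weq M. \<forall>a \<in> hom M (Dom M i) X.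
     \<exists>l \<in> hom M (Cod M i) X. l \<cdot> i = a)" (is "?L \<longleftrightarrow> ?R")
proof
  assume L: ?L
  obtain T where T: "is_terminal M T" by (rule terminal_exists)
  have X: "X \<in> Obj M" using L by (simp add: fibrant_def)
  then obtain t where t: "t \<in> hom M X T" using terminal_map[OF T] by blast
  have tF: "t \<in> Fib M" using L T t unfolding fibrant_def by blast
  show ?R
  proof (intro conjI ballI X)
    fix i a
    assume i: "i \<in> Cof M \<inter> Weq M" and a: "a \<in> hom M (Dom M i) X"
    have iA: "i \<in> Arr M" using i Cof_Arr by auto
    obtain b where b: "b \<in> hom M (Cod M i) T"
      using terminal_map[OF T Cod_closed[OF iA]] by blast
    have "t \<cdot> a \<in> hom M (Dom M i) T" "b \<cdot> i \<in> hom M (Dom M i) T"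
      using t a b iA by (auto simp: hom_def)
    then have "t \<cdot> a = b \<cdot> i" using terminal_unique[OF T] by blast
    then show "\<exists>l \<in> hom M (Cod M i) X. l \<cdot> i = a"
      using trivial_Cof_lift[OF i tF _ t a b] iA unfolding hom_def by blast
  qed
next
  assume R: ?R
  show ?L
    unfolding fibrant_def
  proof (intro conjI allI impI)
    show "X \<in> Obj M" using R by simp
    fix T t
    assume T: "is_terminal M T" and t: "t \<in> hom M X T"
    show "t \<in> Fib M"
    proof (rule Fib_if_lifting)
      show "t \<in> Arr M" using t by (simp add: hom_def)
      fix i assume i: "i \<in> Cof M \<inter> Weq M"
      have iA: "i \<in> Arr M" using i Cof_Arr by auto
      show "has_lifting M i t"
        unfolding has_lifting_def
      proof (intro ballI impI)
        fix a b
        assume a: "a \<in> hom M (Dom M i) (Dom M t)" and b: "b \<in> hom M (Cod M i) (Cod M t)"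
        have d: "Dom M t = X" "Cod M t = T" using t by (auto simp: hom_def)
        obtain l where l: "l \<in> hom M (Cod M i) X" "l \<cdot> i = a" using R i a d by auto
        have "t \<cdot> l \<in> hom M (Cod M i) T" using l t by (auto simp: hom_def)
        then have "t \<cdot> l = b"
          using terminal_unique[OF T] b d by simp
        then show "\<exists>l \<in> hom M (Cod M i) (Dom M t). l \<cdot> i = a \<and> t \<cdot> l = b"
          using l d by auto
      qed
    qed
  qed
qed

lemma cofibrant_iff_lifting:
  "cofibrant M X \<longleftrightarrow> X \<in> Obj M \<and> (\<forall>p \<in> Fib M \<inter> Weq M. \<forall>b \<in> hom M X (Cod M p).
     \<exists>l \<in> hom M X (Dom M p). p \<cdot> l = b)"
  using closed_model_category.fibrant_iff_extension[OF closed_model_category_op_cat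
      [OF closed_model_category_axioms], of X] by simp

lemma fibrant_extend:
  assumes "fibrant M Y" and "i \<in> Cof M \<inter> Weq M" and "i \<in> hom M A B" and "a \<in> hom M A Y"
  shows "\<exists>l \<in> hom M B Y. l \<cdot> i = a"
  using assms by (auto simp: fibrant_iff_extension hom_def)

lemma cofibrant_lift:
  assumes "cofibrant M X" and "p \<in> Fib M \<inter> Weq M" and "p \<in> hom M A B" and "b \<in> hom M X B"
  shows "\<exists>l \<in> hom M X A. p \<cdot> l = b"
  using assms by (auto simp: cofibrant_iff_lifting hom_def)

lemma fibrant_if_trivial_Fib:
  assumes "fibrant M Y" and p: "p \<in> Fib M" "p \<in> hom M X Y"
  shows "fibrant M X"
  unfolding fibrant_iff_extension
proof (intro conjI ballI)
  show "X \<in> Obj M" using hom_Obj p by blast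
  fix i a
  assume i: "i \<in> Cof M \<inter> Weq M" and a: "a \<in> hom M (Dom M i) X"
  have iA: "i \<in> hom M (Dom M i) (Cod M i)" using i Cof_Arr by (auto simp: hom_def)
  have pa: "p \<cdot> a \<in> hom M (Dom M i) Y" using a p by (auto simp: hom_def)
  obtain b where b: "b \<in> hom M (Cod M i) Y" "b \<cdot> i = p \<cdot> a"
    using fibrant_extend[OF assms(1) i iA pa] by blast
  show "\<exists>l \<in> hom M (Cod M i) X. l \<cdot> i = a"
    using trivial_Cof_lift[OF i p(1) iA p(2) a b(1) b(2)[symmetric]] by auto
qed

lemma cofibrant_if_Cof:
  assumes "cofibrant M X" and "i \<in> Cof M" "i \<in> hom M X Y"
  shows "cofibrant M Y"
  using closed_model_category.fibrant_if_trivial_Fib[OF closed_model_category_op_cat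
      [OF closed_model_category_axioms], of X i Y] assms by simp

lemma fibrant_replacement:
  assumes X: "X \<in> Obj M"
  shows "\<exists>Y. \<exists>i \<in> hom M X Y. fibrant M Y \<and> i \<in> Cof M \<inter> Weq M"
proof -
  obtain T where T: "is_terminal M T" by (rule terminal_exists)
  then obtain t where t: "t \<in> hom M X T" using terminal_map[OF _ X] by blast
  then obtain i p where i: "i \<in> Cof M \<inter> Weq M" and p: "p \<in> Fib M" "Cod M i = Dom M p" "p \<cdot> i = t"
    using factor_trivial_Cof[of t] unfolding hom_def by blast
  have a: "i \<in> Arr M" "p \<in> Arr M" using i p Cof_Arr Fib_Arr by auto
  have pT: "p \<in> hom M (Cod M i) T" "i \<in> hom M X (Cod M i)"
    using t p(2,3) a comp_simps(2,3)[of i p] by (auto simp: hom_def)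
  have "fibrant M T"
    unfolding fibrant_iff_extension
  proof (intro conjI ballI)
    show "T \<in> Obj M" using hom_Obj(2)[OF t] .
    fix j b
    assume j: "j \<in> Cof M \<inter> Weq M" and b: "b \<in> hom M (Dom M j) T"
    have jA: "j \<in> Arr M" using j Cof_Arr by auto
    obtain l where l: "l \<in> hom M (Cod M j) T"
      using terminal_map[OF T Cod_closed[OF jA]] by blast
    have "l \<cdot> j \<in> hom M (Dom M j) T" using l jA by (auto simp: hom_def)
    then show "\<exists>l \<in> hom M (Cod M j) T. l \<cdot> j = b"
      using terminal_unique[OF T _ b] l by blast
  qed
  then show ?thesis using fibrant_if_trivial_Fib[OF _ p(1) pT(1)] i pT by blast
qed

lemma cofibrant_replacement:
  assumes "X \<in> Obj M"
  shows "\<exists>Y. \<exists>p \<in> hom M Y X. cofibrant M Y \<and> p \<in> Fib M \<inter> Weq M"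
  using closed_model_category.fibrant_replacement[OF closed_model_category_op_cat
      [OF closed_model_category_axioms], of X] assms by simp

end

section \<open>Limits\<close>

definition is_pullback ::
  "('o, 'a, 'x) modcat_scheme \<Rightarrow> 'a \<Rightarrow> 'a \<Rightarrow> 'o \<Rightarrow> 'a \<Rightarrow> 'a \<Rightarrow> bool" where
  "is_pullback M f g P p q \<longleftrightarrow> p \<in> hom M P (Dom M f) \<and> q \<in> hom M P (Dom M g) \<and>
     f \<cdot>\<^bsub>M\<^esub> p = g \<cdot>\<^bsub>M\<^esub> q \<and>
     (\<forall>T. \<forall>a \<in> hom M T (Dom M f). \<forall>b \<in> hom M T (Dom M g). f \<cdot>\<^bsub>M\<^esub> a = g \<cdot>\<^bsub>M\<^esub> b \<longrightarrow>
        (\<exists>!u. u \<in> hom M T P \<and> p \<cdot>\<^bsub>M\<^esub> u = a \<and> q \<cdot>\<^bsub>M\<^esub> u = b))"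

lemma all_less_2: "(\<forall>i < Suc (Suc 0). P i) \<longleftrightarrow> P 0 \<and> P (Suc 0)"
  by (auto simp: less_Suc_eq)

lemma all_less_3: "(\<forall>i < Suc (Suc (Suc 0)). P i) \<longleftrightarrow> P 0 \<and> P (Suc 0) \<and> P (Suc (Suc 0))"
  by (auto simp: less_Suc_eq)

lemma all_less_5: "(\<forall>i < Suc (Suc (Suc (Suc (Suc 0)))). P i) \<longleftrightarrow>
  P 0 \<and> P (Suc 0) \<and> P (Suc (Suc 0)) \<and> P (Suc (Suc (Suc 0))) \<and> P (Suc (Suc (Suc (Suc 0))))"
  by (auto simp: less_Suc_eq)

context closed_model_category
begin

lemmas op_model = closed_model_category_op_cat[OF closed_model_category_axioms]

lemma product_exists:
  assumes "X \<in> Obj M" and "Y \<in> Obj M"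
  shows "\<exists>P p q. is_product M X Y P p q"
proof -
  have "finite_diagram M [X, Y] []" using assms by (simp add: finite_diagram_def)
  then obtain P l where L: "is_limit M [X, Y] [] P l"
    using limits unfolding has_finite_limits_def by blast
  have "is_product M X Y P (l 0) (l 1)"
    unfolding is_product_def
  proof (intro conjI allI ballI)
    show "l 0 \<in> hom M P X" "l 1 \<in> hom M P Y"
      using L by (simp_all add: is_limit_def is_cone_def all_less_2)
    fix T a b
    assume a: "a \<in> hom M T X" and b: "b \<in> hom M T Y"
    have "is_cone M [X, Y] [] T (\<lambda>i. if i = 0 then a else b)"
      using a b hom_Obj(1)[OF a] by (simp add: is_cone_def all_less_2)
    then have "\<exists>!u. u \<in> hom M T P \<and> (\<forall>i < length [X, Y]. l i \<cdot> u = (if i = 0 then a else b))"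
      using L[unfolded is_limit_def] by blast
    then show "\<exists>!u. u \<in> hom M T P \<and> l 0 \<cdot> u = a \<and> l 1 \<cdot> u = b"
      by (simp add: all_less_2)
  qed
  then show ?thesis by blast
qed

lemma pullback_exists:
  assumes f: "f \<in> hom M X Z" and g: "g \<in> hom M Y Z"
  shows "\<exists>P p q. is_pullback M f g P p q"
proof -
  let ?ds = "[X, Y, Z]" and ?es = "[(0, 2, f), (1, 2, g)]"
  have d: "Dom M f = X" "Dom M g = Y" using f g by (auto simp: hom_def)
  have "finite_diagram M ?ds ?es"
    using f g hom_Obj[OF f] hom_Obj[OF g] by (simp add: finite_diagram_def)
  then obtain P l where L: "is_limit M ?ds ?es P l"
    using limits unfolding has_finite_limits_def by blast
  then have l: "l 0 \<in> hom M P X" "l 1 \<in> hom M P Y" "f \<cdot> l 0 = l 2" "g \<cdot> l 1 = l 2"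
    by (simp_all add: is_limit_def is_cone_def all_less_3)
  have "is_pullback M f g P (l 0) (l 1)"
    unfolding is_pullback_def d
  proof (intro conjI allI ballI impI)
    show "l 0 \<in> hom M P X" "l 1 \<in> hom M P Y" "f \<cdot> l 0 = g \<cdot> l 1"
      using l by simp_all
    fix T a b
    assume a: "a \<in> hom M T X" and b: "b \<in> hom M T Y" and e: "f \<cdot> a = g \<cdot> b"
    have fa: "f \<cdot> a \<in> hom M T Z" using f a by (auto simp: hom_def)
    have "is_cone M ?ds ?es T (\<lambda>i. if i = 0 then a else if i = 1 then b else f \<cdot> a)"
      using a b fa e hom_Obj(1)[OF a] by (simp add: is_cone_def all_less_3)
    then have "\<exists>!u. u \<in> hom M T P \<and> (\<forall>i < length ?ds. l i \<cdot> u =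
        (if i = 0 then a else if i = 1 then b else f \<cdot> a))"
      using L[unfolded is_limit_def] by blast
    moreover have "l 2 \<cdot> u = f \<cdot> a" if "u \<in> hom M T P" "l 0 \<cdot> u = a" for u
      using reassoc[of f "l 0" "l 2" u] l f that by (auto simp: hom_def)
    ultimately show "\<exists>!u. u \<in> hom M T P \<and> l 0 \<cdot> u = a \<and> l 1 \<cdot> u = b"
      by (simp add: all_less_3 numeral_2_eq_2 cong: conj_cong)
  qed
  then show ?thesis by blast
qed

lemma pullback_map:
  assumes "is_pullback M f g P p q" and "f \<in> hom M X Z" and "g \<in> hom M Y Z"
    and "a \<in> hom M T X" and "b \<in> hom M T Y" and "f \<cdot> a = g \<cdot> b"
  shows "\<exists>u \<in> hom M T P. p \<cdot> u = a \<and> q \<cdot> u = b"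
proof -
  have "Dom M f = X" "Dom M g = Y" using assms(2,3) by (auto simp: hom_def)
  then show ?thesis using assms unfolding is_pullback_def by blast
qed

lemma pullback_ext:
  assumes P: "is_pullback M f g P p q" and f: "f \<in> hom M X Z" and g: "g \<in> hom M Y Z"
    and u: "u \<in> hom M T P" and v: "v \<in> hom M T P" and e: "p \<cdot> u = p \<cdot> v" "q \<cdot> u = q \<cdot> v"
  shows "u = v"
proof -
  have d: "Dom M f = X" "Dom M g = Y" using f g by (auto simp: hom_def)
  have p: "p \<in> hom M P X" "q \<in> hom M P Y" "f \<cdot> p = g \<cdot> q"
    using P by (simp_all add: is_pullback_def d)
  have "p \<cdot> v \<in> hom M T X" "q \<cdot> v \<in> hom M T Y" "f \<cdot> (p \<cdot> v) = g \<cdot> (q \<cdot> v)"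
    using p f g v comp_assoc[of v p f] comp_assoc[of v q g] by (auto simp: hom_def)
  then have "\<exists>!w. w \<in> hom M T P \<and> p \<cdot> w = p \<cdot> v \<and> q \<cdot> w = q \<cdot> v"
    using P unfolding is_pullback_def d by blast
  then show ?thesis using u v e by blast
qed

lemma pullback_trivial_Fib:
  assumes P: "is_pullback M f g P p q" and f: "f \<in> hom M X Z" and g: "g \<in> hom M Y Z"
    and gF: "g \<in> Fib M \<inter> Weq M"
  shows "p \<in> Fib M \<inter> Weq M"
proof (rule trivial_Fib_if_lifting)
  have d: "Dom M f = X" "Dom M g = Y" using f g by (auto simp: hom_def)
  have p: "p \<in> hom M P X" and q: "q \<in> hom M P Y" and e: "f \<cdot> p = g \<cdot> q"
    using P by (simp_all add: is_pullback_def d)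
  show "p \<in> Arr M" using p by (simp add: hom_def)
  fix i assume i: "i \<in> Cof M"
  have iA: "i \<in> hom M (Dom M i) (Cod M i)" using i Cof_Arr by (auto simp: hom_def)
  show "has_lifting M i p"
    unfolding has_lifting_def
  proof (intro ballI impI)
    fix a b
    assume a: "a \<in> hom M (Dom M i) (Dom M p)" and b: "b \<in> hom M (Cod M i) (Cod M p)"
      and ab: "p \<cdot> a = b \<cdot> i"
    have dp: "Dom M p = P" "Cod M p = X" using p by (auto simp: hom_def)
    have fb: "f \<cdot> b \<in> hom M (Cod M i) Z" and qa: "q \<cdot> a \<in> hom M (Dom M i) Y"
      using f b q a dp by (auto simp: hom_def)
    have "g \<cdot> (q \<cdot> a) = (f \<cdot> b) \<cdot> i"
    proof -
      have "g \<cdot> (q \<cdot> a) = f \<cdot> (p \<cdot> a)"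
        using comp_assoc[of a p f] comp_assoc[of a q g] e a p q f g dp by (simp add: hom_def)
      also have "\<dots> = (f \<cdot> b) \<cdot> i"
        using ab comp_assoc[of i b f] b f iA dp by (simp add: hom_def)
      finally show ?thesis .
    qed
    then obtain m where m: "m \<in> hom M (Cod M i) Y" "m \<cdot> i = q \<cdot> a" "g \<cdot> m = f \<cdot> b"
      using trivial_Fib_lift[OF gF i iA g qa fb] by blast
    have b': "b \<in> hom M (Cod M i) X" using b dp by simp
    obtain u where u: "u \<in> hom M (Cod M i) P" "p \<cdot> u = b" "q \<cdot> u = m"
      using P m b' unfolding is_pullback_def d by metis
    have "u \<cdot> i = a"
    proof -
      have "u \<cdot> i \<in> hom M (Dom M i) P" "p \<cdot> (u \<cdot> i) = p \<cdot> a" "q \<cdot> (u \<cdot> i) = q \<cdot> a"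
        using u iA p q reassoc[OF u(2), of i] reassoc[OF u(3), of i] ab m
        by (auto simp: hom_def)
      moreover have "p \<cdot> a \<in> hom M (Dom M i) X" "f \<cdot> (p \<cdot> a) = g \<cdot> (q \<cdot> a)"
        using comp_assoc[of a p f] comp_assoc[of a q g] e a p q f g dp by (auto simp: hom_def)
      moreover have "a \<in> hom M (Dom M i) P" using a dp by simp
      ultimately show ?thesis
        using P qa unfolding is_pullback_def d by metis
    qed
    then show "\<exists>l \<in> hom M (Cod M i) (Dom M p). l \<cdot> i = a \<and> p \<cdot> l = b"
      using u dp by auto
  qed
qed


section \<open>Cylinders and path objects\<close>

lemma cylinderD:
  assumes "cylinder M X c"
  shows "proj c \<in> hom M (Dom M (proj c)) X" and "end0 c \<in> hom M X (Dom M (proj c))"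
    and "end1 c \<in> hom M X (Dom M (proj c))" and "proj c \<in> Weq M"
    and "proj c \<cdot> end0 c = Id M X" and "proj c \<cdot> end1 c = Id M X"
  using assms by (simp_all add: cylinder_def Let_def)

lemma path_objectD:
  assumes "path_object M Y q"
  shows "proj q \<in> hom M Y (Cod M (proj q))" and "end0 q \<in> hom M (Cod M (proj q)) Y"
    and "end1 q \<in> hom M (Cod M (proj q)) Y" and "proj q \<in> Weq M"
    and "end0 q \<cdot> proj q = Id M Y" and "end1 q \<cdot> proj q = Id M Y"
  using assms by (simp_all add: cylinder_def Let_def)

text \<open>Factoring \<open>X + X \<rightarrow> B\<close> as a cofibration and a trivial fibration gives a cylinder that lies
  over \<open>B\<close>, since \<open>B \<rightarrow> X\<close> is a trivial fibration too. For \<open>B = X\<close> this is the usual construction.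
  A larger \<open>B\<close> lets the cylinder carry a prescribed homotopy, the one which a map out of \<open>B\<close>
  restricts to, while maps into the cylinder can still be obtained by lifting.\<close>

lemma cylinder_over:
  assumes X: "X \<in> Obj M" and b: "b \<in> Fib M \<inter> Weq M" "b \<in> hom M B X"
    and s0: "s0 \<in> hom M X B" "b \<cdot> s0 = Id M X" and s1: "s1 \<in> hom M X B" "b \<cdot> s1 = Id M X"
  shows "\<exists>c. cylinder M X c \<and> (\<exists>t \<in> hom M (Dom M (proj c)) B. t \<in> Fib M \<inter> Weq M \<and>
    t \<cdot> end0 c = s0 \<and> t \<cdot> end1 c = s1 \<and> b \<cdot> t = proj c)"
proof -
  obtain S j0 j1 where S: "is_product (op_cat M) X X S j0 j1"
    using closed_model_category.product_exists[OF op_model, of X X] X by auto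
  have j: "j0 \<in> hom M X S" "j1 \<in> hom M X S" using S by (simp_all add: is_product_def)
  have "\<exists>!u. u \<in> hom M S B \<and> u \<cdot> j0 = s0 \<and> u \<cdot> j1 = s1"
    using S s0(1) s1(1) unfolding is_product_def by simp
  then obtain s where s: "s \<in> hom M S B" "s \<cdot> j0 = s0" "s \<cdot> j1 = s1"
    by blast
  obtain k t where k: "k \<in> Cof M" and t: "t \<in> Fib M \<inter> Weq M" "Cod M k = Dom M t" "t \<cdot> k = s"
    using factor_trivial_Fib[of s] s unfolding hom_def by blast
  have a: "k \<in> Arr M" "t \<in> Arr M" using k t Cof_Arr Fib_Arr by auto
  have kh: "k \<in> hom M S (Dom M t)" "t \<in> hom M (Dom M t) B"
    using s(1) t(2,3) a comp_simps(2,3)[of k t] by (auto simp: hom_def)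
  define c where "c = \<lparr>end0 = k \<cdot> j0, end1 = k \<cdot> j1, proj = b \<cdot> t\<rparr>"
  have bt: "b \<cdot> t \<in> hom M (Dom M t) X" "b \<cdot> t \<in> Weq M"
    using b kh Weq_comp[OF kh(2) b(2)] t by (auto simp: hom_def)
  have I: "Dom M (proj c) = Dom M t" using bt by (simp add: c_def hom_def)
  have te: "t \<cdot> (k \<cdot> j0) = s0" "t \<cdot> (k \<cdot> j1) = s1"
    using reassoc[OF t(3), of j0] reassoc[OF t(3), of j1] kh j s by (simp_all add: hom_def)
  have "cylinder M X c"
    unfolding cylinder_def Let_def I
  proof (intro conjI)
    show "proj c \<in> hom M (Dom M t) X" "proj c \<in> Weq M" using bt by (simp_all add: c_def)
    show "end0 c \<in> hom M X (Dom M t)" "end1 c \<in> hom M X (Dom M t)"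
      using kh j by (auto simp: c_def hom_def)
    show "proj c \<cdot> end0 c = Id M X" "proj c \<cdot> end1 c = Id M X"
      using b kh j te s0 s1 by (simp_all add: c_def hom_def)
    show "\<exists>S j0 j1 k. is_product (op_cat M) X X S j0 j1 \<and> k \<in> hom M S (Dom M t) \<and>
        k \<cdot> j0 = end0 c \<and> k \<cdot> j1 = end1 c \<and> k \<in> Cof M"
      using S k kh unfolding c_def by auto
  qed
  moreover have "t \<cdot> end0 c = s0" "t \<cdot> end1 c = s1" "b \<cdot> t = proj c"
    using te by (simp_all add: c_def)
  ultimately show ?thesis using t kh I by metis
qed

lemma cylinder_exists: "X \<in> Obj M \<Longrightarrow> \<exists>c. cylinder M X c"
  using cylinder_over[of X "Id M X" X "Id M X" "Id M X"] Id_trivial_Fib[of X] Id_closed[of X]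
  by auto

lemma path_object_exists: "Y \<in> Obj M \<Longrightarrow> \<exists>q. path_object M Y q"
  using closed_model_category.cylinder_exists[OF op_model] by simp

lemma cylinder_swap:
  assumes "cylinder M X c"
  shows "cylinder M X \<lparr>end0 = end1 c, end1 = end0 c, proj = proj c\<rparr>"
proof -
  obtain S j0 j1 k where S: "is_product (op_cat M) X X S j0 j1"
    and k: "k \<in> hom M S (Dom M (proj c))" "k \<cdot> j0 = end0 c" "k \<cdot> j1 = end1 c" "k \<in> Cof M"
    using assms unfolding cylinder_def Let_def by auto
  have "is_product (op_cat M) X X S j1 j0"
    unfolding is_product_def
  proof (intro conjI allI ballI)
    show "j1 \<in> hom (op_cat M) S X" "j0 \<in> hom (op_cat M) S X"
      using S by (simp_all add: is_product_def)
    fix T a b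
    assume "a \<in> hom (op_cat M) T X" "b \<in> hom (op_cat M) T X"
    then have "\<exists>!u. u \<in> hom (op_cat M) T S \<and> Comp (op_cat M) j0 u = b \<and> Comp (op_cat M) j1 u = a"
      using S unfolding is_product_def by simp
    then show "\<exists>!u. u \<in> hom (op_cat M) T S \<and> Comp (op_cat M) j1 u = a \<and> Comp (op_cat M) j0 u = b"
      by blast
  qed
  then show ?thesis
    using k cylinderD[OF assms] unfolding cylinder_def Let_def by auto
qed

text \<open>The two ends of a cylinder together form a cofibration. Treating them separately spares the
  coproduct in all later lifting problems.\<close>

lemma cylinder_lift:
  assumes c: "cylinder M X c" and p: "p \<in> Fib M \<inter> Weq M" "p \<in> hom M A B"
    and a0: "a0 \<in> hom M X A" and a1: "a1 \<in> hom M X A" and b: "b \<in> hom M (Dom M (proj c)) B"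
    and e0: "p \<cdot> a0 = b \<cdot> end0 c" and e1: "p \<cdot> a1 = b \<cdot> end1 c"
  shows "\<exists>l \<in> hom M (Dom M (proj c)) A. l \<cdot> end0 c = a0 \<and> l \<cdot> end1 c = a1 \<and> p \<cdot> l = b"
proof -
  obtain S j0 j1 k where S: "is_product (op_cat M) X X S j0 j1"
    and k: "k \<in> hom M S (Dom M (proj c))" "k \<cdot> j0 = end0 c" "k \<cdot> j1 = end1 c" "k \<in> Cof M"
    using c unfolding cylinder_def Let_def by auto
  have j: "j0 \<in> hom M X S" "j1 \<in> hom M X S" using S by (simp_all add: is_product_def)
  have uniq: "\<exists>!u. u \<in> hom M S T \<and> u \<cdot> j0 = x \<and> u \<cdot> j1 = y"
    if "x \<in> hom M X T" "y \<in> hom M X T" for T x y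
    using S that unfolding is_product_def by simp
  obtain a where a: "a \<in> hom M S A" "a \<cdot> j0 = a0" "a \<cdot> j1 = a1"
    using uniq[OF a0 a1] by blast
  have "p \<cdot> a = b \<cdot> k"
  proof -
    have x: "p \<cdot> a0 \<in> hom M X B" "p \<cdot> a1 \<in> hom M X B" using p a0 a1 by (auto simp: hom_def)
    have "p \<cdot> a \<in> hom M S B \<and> (p \<cdot> a) \<cdot> j0 = p \<cdot> a0 \<and> (p \<cdot> a) \<cdot> j1 = p \<cdot> a1"
      using p a j by (auto simp: hom_def)
    moreover have "b \<cdot> k \<in> hom M S B \<and> (b \<cdot> k) \<cdot> j0 = p \<cdot> a0 \<and> (b \<cdot> k) \<cdot> j1 = p \<cdot> a1"
      using b k j e0 e1 by (auto simp: hom_def)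
    ultimately show ?thesis using uniq[OF x] by blast
  qed
  then obtain l where l: "l \<in> hom M (Dom M (proj c)) A" "l \<cdot> k = a" "p \<cdot> l = b"
    using trivial_Fib_lift[OF p(1) k(4) k(1) p(2) a(1) b] by blast
  have "l \<cdot> end0 c = a0" "l \<cdot> end1 c = a1"
    using reassoc[OF l(2), of j0] reassoc[OF l(2), of j1] l k a j by (simp_all add: hom_def)
  then show ?thesis using l by blast
qed

lemma path_lift:
  assumes "path_object M Y q" and "i \<in> Cof M \<inter> Weq M" and "i \<in> hom M A B"
    and "b0 \<in> hom M B Y" and "b1 \<in> hom M B Y" and "a \<in> hom M A (Cod M (proj q))"
    and "b0 \<cdot> i = end0 q \<cdot> a" and "b1 \<cdot> i = end1 q \<cdot> a"
  shows "\<exists>l \<in> hom M B (Cod M (proj q)). end0 q \<cdot> l = b0 \<and> end1 q \<cdot> l = b1 \<and> l \<cdot> i = a"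
  using closed_model_category.cylinder_lift[OF op_model, of Y q i B A b0 b1 a] assms by simp

text \<open>A lift on the free end exists because \<open>X\<close> is cofibrant; the lifting property of the pair of
  ends then provides the rest.\<close>

lemma cylinder_end0:
  assumes X: "cofibrant M X" and c: "cylinder M X c"
  shows "end0 c \<in> Cof M \<inter> Weq M"
proof
  note [simp] = hom_def
  note d = cylinderD[OF c]
  show "end0 c \<in> Cof M"
  proof (rule Cof_if_lifting)
    show "end0 c \<in> Arr M" using d by simp
    fix p assume p: "p \<in> Fib M \<inter> Weq M"
    have pA: "p \<in> hom M (Dom M p) (Cod M p)" using p Fib_Arr by auto
    show "has_lifting M (end0 c) p"
      unfolding has_lifting_def
    proof (intro ballI impI)
      fix a b
      assume a: "a \<in> hom M (Dom M (end0 c)) (Dom M p)"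
        and b: "b \<in> hom M (Cod M (end0 c)) (Cod M p)" and e: "p \<cdot> a = b \<cdot> end0 c"
      have be: "b \<cdot> end1 c \<in> hom M X (Cod M p)" using b d by simp
      obtain a1 where a1: "a1 \<in> hom M X (Dom M p)" "p \<cdot> a1 = b \<cdot> end1 c"
        using cofibrant_lift[OF X p pA be] by blast
      have a': "a \<in> hom M X (Dom M p)" "b \<in> hom M (Dom M (proj c)) (Cod M p)"
        using a b d by simp_all
      show "\<exists>l \<in> hom M (Cod M (end0 c)) (Dom M p). l \<cdot> end0 c = a \<and> p \<cdot> l = b"
        using cylinder_lift[OF c p pA a'(1) a1(1) a'(2) e a1(2)] d by auto
    qed
  qed
  show "end0 c \<in> Weq M"
    using Weq_cancel_left[OF d(2) d(1) d(4)] d Id_Weq hom_Obj(1)[OF d(2)] by simp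
qed

lemma cylinder_end1:
  assumes "cofibrant M X" and "cylinder M X c"
  shows "end1 c \<in> Cof M \<inter> Weq M"
  using cylinder_end0[OF assms(1) cylinder_swap[OF assms(2)]] by simp

lemma path_end0: "fibrant M Y \<Longrightarrow> path_object M Y q \<Longrightarrow> end0 q \<in> Fib M \<inter> Weq M"
  using closed_model_category.cylinder_end0[OF op_model] by auto

lemma path_end1: "fibrant M Y \<Longrightarrow> path_object M Y q \<Longrightarrow> end1 q \<in> Fib M \<inter> Weq M"
  using closed_model_category.cylinder_end1[OF op_model] by auto

end

section \<open>The homotopy relation\<close>

context closed_model_category
begin

lemma fibrant_Obj: "fibrant M X \<Longrightarrow> X \<in> Obj M"
  by (simp add: fibrant_def)

lemma cofibrant_Obj: "cofibrant M X \<Longrightarrow> X \<in> Obj M"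
  by (simp add: fibrant_def)

lemma is_homotopyD:
  assumes "is_homotopy M X Y c h f g"
  shows "f \<in> hom M X Y" and "g \<in> hom M X Y" and "cylinder M X c"
    and "h \<in> hom M (Dom M (proj c)) Y" and "h \<cdot> end0 c = f" and "h \<cdot> end1 c = g"
  using assms by (simp_all add: is_homotopy_def)

text \<open>One lift against the path fibration composes a right homotopy with a left one. With a
  constant right homotopy this turns left homotopies into right ones, and in general it yields
  transitivity without gluing cylinders or path objects.\<close>

lemma right_homotopy_trans_left:
  assumes X: "cofibrant M X" and q: "path_object M Y q" and h: "is_homotopy M X Y c h g k"
    and r: "r \<in> hom M X (Cod M (proj q))" "end0 q \<cdot> r = f" "end1 q \<cdot> r = g"
  shows "\<exists>r \<in> hom M X (Cod M (proj q)). end0 q \<cdot> r = f \<and> end1 q \<cdot> r = k"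
proof -
  note hD = is_homotopyD[OF h]
  note c = cylinderD[OF hD(3)] and qD = path_objectD[OF q]
  have f: "f \<in> hom M X Y" using r qD by (auto simp: hom_def)
  have b0: "f \<cdot> proj c \<in> hom M (Dom M (proj c)) Y" using f c by (auto simp: hom_def)
  have e: "(f \<cdot> proj c) \<cdot> end0 c = end0 q \<cdot> r" "h \<cdot> end0 c = end1 q \<cdot> r"
    using f c r hD by (simp_all add: hom_def)
  obtain K where K: "K \<in> hom M (Dom M (proj c)) (Cod M (proj q))"
    "end0 q \<cdot> K = f \<cdot> proj c" "end1 q \<cdot> K = h"
    using path_lift[OF q cylinder_end0[OF X hD(3)] c(2) b0 hD(4) r(1) e] by blast
  have "end0 q \<cdot> (K \<cdot> end1 c) = f" "end1 q \<cdot> (K \<cdot> end1 c) = k"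
    using reassoc[OF K(2), of "end1 c"] reassoc[OF K(3), of "end1 c"] K(1) f c qD hD
    by (simp_all add: hom_def)
  moreover have "K \<cdot> end1 c \<in> hom M X (Cod M (proj q))" using K(1) c by (auto simp: hom_def)
  ultimately show ?thesis by blast
qed

lemma right_homotopy_if_left:
  assumes X: "cofibrant M X" and q: "path_object M Y q" and h: "is_homotopy M X Y c h f g"
  shows "\<exists>r \<in> hom M X (Cod M (proj q)). end0 q \<cdot> r = f \<and> end1 q \<cdot> r = g"
proof -
  note qD = path_objectD[OF q] and f = is_homotopyD(1)[OF h]
  show ?thesis
    by (rule right_homotopy_trans_left[OF X q h, of "proj q \<cdot> f"])
      (use qD f reassoc[OF qD(5), of f] reassoc[OF qD(6), of f] in \<open>auto simp: hom_def\<close>)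
qed

text \<open>Half of Quillen's correspondence, from right to left homotopies: evaluating \<open>K\<close> at \<open>end0 q\<close>
  gives a left homotopy, and \<open>K\<close> is the double homotopy required by \<open>corresponding\<close>.\<close>

lemma double_homotopy_from_right:
  assumes c: "cylinder M X c" and Y: "fibrant M Y" and q: "path_object M Y q"
    and k: "k \<in> hom M X (Cod M (proj q))"
  shows "\<exists>K \<in> hom M (Dom M (proj c)) (Cod M (proj q)). K \<cdot> end0 c = k \<and>
    K \<cdot> end1 c = proj q \<cdot> (end1 q \<cdot> k) \<and> end1 q \<cdot> K = (end1 q \<cdot> k) \<cdot> proj c"
proof -
  note qD = path_objectD[OF q] and cD = cylinderD[OF c]
  have a1: "proj q \<cdot> (end1 q \<cdot> k) \<in> hom M X (Cod M (proj q))"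
    and b: "(end1 q \<cdot> k) \<cdot> proj c \<in> hom M (Dom M (proj c)) Y"
    using qD cD k by (auto simp: hom_def)
  have "end1 q \<cdot> k = ((end1 q \<cdot> k) \<cdot> proj c) \<cdot> end0 c"
    "end1 q \<cdot> (proj q \<cdot> (end1 q \<cdot> k)) = ((end1 q \<cdot> k) \<cdot> proj c) \<cdot> end1 c"
    using qD cD k reassoc[OF qD(6), of "end1 q \<cdot> k"] by (simp_all add: hom_def)
  then show ?thesis
    using cylinder_lift[OF c path_end1[OF Y q] qD(3) k a1 b] by blast
qed

text \<open>Each direction works for any cylinder and any path object, so the relation depends on
  neither.\<close>

lemma homotopic_iff_right:
  assumes X: "cofibrant M X" and Y: "fibrant M Y" and q: "path_object M Y q"
    and f: "f \<in> hom M X Y" and g: "g \<in> hom M X Y"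
  shows "homotopic M f g \<longleftrightarrow>
    (\<exists>r \<in> hom M X (Cod M (proj q)). end0 q \<cdot> r = f \<and> end1 q \<cdot> r = g)"
proof
  assume "homotopic M f g"
  then obtain X' Y' c h where h: "is_homotopy M X' Y' c h f g" by (auto simp: homotopic_def)
  have "X' = X" "Y' = Y" using is_homotopyD(1)[OF h] f by (auto simp: hom_def)
  then show "\<exists>r \<in> hom M X (Cod M (proj q)). end0 q \<cdot> r = f \<and> end1 q \<cdot> r = g"
    using right_homotopy_if_left[OF X q] h by blast
next
  assume "\<exists>r \<in> hom M X (Cod M (proj q)). end0 q \<cdot> r = f \<and> end1 q \<cdot> r = g"
  then obtain r where r: "r \<in> hom M X (Cod M (proj q))" "end0 q \<cdot> r = f" "end1 q \<cdot> r = g"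
    by blast
  obtain c where c: "cylinder M X c" using cylinder_exists cofibrant_Obj[OF X] by blast
  note qD = path_objectD[OF q] and cD = cylinderD[OF c]
  obtain K where K: "K \<in> hom M (Dom M (proj c)) (Cod M (proj q))" "K \<cdot> end0 c = r"
    "K \<cdot> end1 c = proj q \<cdot> g"
    using double_homotopy_from_right[OF c Y q r(1)] r(3) by auto
  have "is_homotopy M X Y c (end0 q \<cdot> K) f g"
    unfolding is_homotopy_def
    using f g c K(1) qD cD K r reassoc[OF qD(5), of g] by (auto simp: hom_def)
  then show "homotopic M f g" by (auto simp: homotopic_def)
qed

lemma right_homotopyE:
  assumes "cofibrant M X" and "fibrant M Y" and "homotopic M f g"
    and "f \<in> hom M X Y" and "g \<in> hom M X Y" and "path_object M Y q"
  obtains r where "r \<in> hom M X (Cod M (proj q))" and "end0 q \<cdot> r = f" and "end1 q \<cdot> r = g"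
  using homotopic_iff_right[of X Y q f g] assms by blast

lemma homotopic_refl:
  assumes X: "cofibrant M X" and Y: "fibrant M Y" and f: "f \<in> hom M X Y"
  shows "homotopic M f f"
proof -
  obtain q where q: "path_object M Y q" using path_object_exists fibrant_Obj[OF Y] by blast
  note qD = path_objectD[OF q]
  show ?thesis
    unfolding homotopic_iff_right[OF X Y q f f]
    by (rule bexI[of _ "proj q \<cdot> f"])
      (use qD f reassoc[OF qD(5), of f] reassoc[OF qD(6), of f] in \<open>auto simp: hom_def\<close>)
qed

lemma homotopic_sym:
  assumes "homotopic M f g"
  shows "homotopic M g f"
proof -
  obtain X Y c h where "is_homotopy M X Y c h f g" using assms by (auto simp: homotopic_def)
  then have "is_homotopy M X Y \<lparr>end0 = end1 c, end1 = end0 c, proj = proj c\<rparr> h g f"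
    using cylinder_swap by (auto simp: is_homotopy_def)
  then show ?thesis by (auto simp: homotopic_def)
qed

lemma homotopic_trans:
  assumes X: "cofibrant M X" and Y: "fibrant M Y" and f: "f \<in> hom M X Y"
    and fg: "homotopic M f g" and gk: "homotopic M g k"
  shows "homotopic M f k"
proof -
  obtain q where q: "path_object M Y q" using path_object_exists fibrant_Obj[OF Y] by blast
  obtain X1 Y1 c1 h1 where h1: "is_homotopy M X1 Y1 c1 h1 f g"
    using fg by (auto simp: homotopic_def)
  obtain X2 Y2 c2 h2 where h2: "is_homotopy M X2 Y2 c2 h2 g k"
    using gk by (auto simp: homotopic_def)
  have e: "X1 = X" "Y1 = Y" "X2 = X" "Y2 = Y"
    using is_homotopyD(1,2)[OF h1] is_homotopyD(1)[OF h2] f by (auto simp: hom_def)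
  obtain r where "r \<in> hom M X (Cod M (proj q))" "end0 q \<cdot> r = f" "end1 q \<cdot> r = g"
    using right_homotopy_if_left[OF X q] h1 e by blast
  then have "\<exists>r \<in> hom M X (Cod M (proj q)). end0 q \<cdot> r = f \<and> end1 q \<cdot> r = k"
    using right_homotopy_trans_left[OF X q] h2 e by blast
  moreover have "k \<in> hom M X Y" using is_homotopyD(2)[OF h2] e by simp
  ultimately show ?thesis using homotopic_iff_right[OF X Y q f] by blast
qed

lemma homotopic_comp_left:
  assumes "homotopic M f g" and "f \<in> hom M X Y" and w: "w \<in> hom M Y Z"
  shows "homotopic M (w \<cdot> f) (w \<cdot> g)"
proof -
  obtain X' Y' c h where h: "is_homotopy M X' Y' c h f g"
    using assms(1) by (auto simp: homotopic_def)
  note hD = is_homotopyD[OF h]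
  have e: "X' = X" "Y' = Y" using hD(1) assms(2) by (auto simp: hom_def)
  have "is_homotopy M X Z c (w \<cdot> h) (w \<cdot> f) (w \<cdot> g)"
    unfolding is_homotopy_def using hD e w cylinderD[OF hD(3)] by (auto simp: hom_def)
  then show ?thesis by (auto simp: homotopic_def)
qed

lemma homotopic_comp_right:
  assumes X: "cofibrant M X" and Y: "fibrant M Y" and W: "cofibrant M W"
    and f: "f \<in> hom M X Y" and g: "g \<in> hom M X Y" and w: "w \<in> hom M W X"
    and fg: "homotopic M f g"
  shows "homotopic M (f \<cdot> w) (g \<cdot> w)"
proof -
  obtain q where q: "path_object M Y q" using path_object_exists fibrant_Obj[OF Y] by blast
  obtain r where r: "r \<in> hom M X (Cod M (proj q))" "end0 q \<cdot> r = f" "end1 q \<cdot> r = g"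
    by (rule right_homotopyE[OF X Y fg f g q])
  have fw: "f \<cdot> w \<in> hom M W Y" "g \<cdot> w \<in> hom M W Y" using f g w by (auto simp: hom_def)
  show ?thesis
    unfolding homotopic_iff_right[OF W Y q fw]
    by (rule bexI[of _ "r \<cdot> w"])
      (use path_objectD[OF q] r w reassoc[OF r(2), of w] reassoc[OF r(3), of w]
        in \<open>auto simp: hom_def\<close>)
qed

text \<open>K. Brown's factorisation. It reduces facts about weak equivalences between cofibrant objects
  to trivial cofibrations and to trivial fibrations with a section, both of which lifting can
  handle.\<close>

lemma Weq_factor_section:
  assumes w: "w \<in> hom M E P" "w \<in> Weq M" and P: "cofibrant M P"
  shows "\<exists>N. \<exists>i \<in> hom M E N. \<exists>\<pi> \<in> hom M N P. \<exists>s \<in> hom M P N. i \<in> Cof M \<inter> Weq M \<and>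
    \<pi> \<in> Fib M \<inter> Weq M \<and> \<pi> \<cdot> i = w \<and> \<pi> \<cdot> s = Id M P"
proof -
  obtain i \<pi> where i: "i \<in> Cof M" and \<pi>: "\<pi> \<in> Fib M \<inter> Weq M" "Cod M i = Dom M \<pi>" "\<pi> \<cdot> i = w"
    using factor_trivial_Fib[of w] w unfolding hom_def by blast
  have a: "i \<in> Arr M" "\<pi> \<in> Arr M" using i \<pi> Cof_Arr Fib_Arr by auto
  have h: "i \<in> hom M E (Dom M \<pi>)" "\<pi> \<in> hom M (Dom M \<pi>) P"
    using w(1) \<pi>(2,3) a comp_simps(2,3)[of i \<pi>] by (auto simp: hom_def)
  have "i \<in> Weq M" using Weq_cancel_left[OF h] \<pi> w(2) by simp
  moreover obtain s where "s \<in> hom M P (Dom M \<pi>)" "\<pi> \<cdot> s = Id M P"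
    using cofibrant_lift[OF P \<pi>(1) h(2) Id_closed[OF cofibrant_Obj[OF P]]] by blast
  ultimately show ?thesis using i \<pi> h by blast
qed

text \<open>This and the next lemma say that precomposition with \<open>w\<close> is a bijection between homotopy
  classes of maps into \<open>Y\<close>: here it is surjective, there injective.\<close>

lemma Weq_extend:
  assumes w: "w \<in> hom M E P" "w \<in> Weq M" and E: "cofibrant M E" and P: "cofibrant M P"
    and Y: "fibrant M Y" and z: "z \<in> hom M E Y"
  shows "\<exists>\<phi> \<in> hom M P Y. homotopic M (\<phi> \<cdot> w) z"
proof -
  obtain N i \<pi> s where i: "i \<in> hom M E N" "i \<in> Cof M \<inter> Weq M"
    and \<pi>: "\<pi> \<in> hom M N P" "\<pi> \<in> Fib M \<inter> Weq M" "\<pi> \<cdot> i = w"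
    and s: "s \<in> hom M P N" "\<pi> \<cdot> s = Id M P"
    using Weq_factor_section[OF w P] by blast
  have N: "cofibrant M N" using cofibrant_if_Cof[OF E _ i(1)] i by blast
  obtain \<xi> where \<xi>: "\<xi> \<in> hom M N Y" "\<xi> \<cdot> i = z" using fibrant_extend[OF Y i(2,1) z] by blast
  obtain c where c: "cylinder M N c" using cylinder_exists cofibrant_Obj[OF N] by blast
  note cD = cylinderD[OF c]
  have s\<pi>: "s \<cdot> \<pi> \<in> hom M N N" and b: "\<pi> \<cdot> proj c \<in> hom M (Dom M (proj c)) P"
    using s \<pi> cD by (auto simp: hom_def)
  have IdN: "Id M N \<in> hom M N N" using Id_closed cofibrant_Obj[OF N] by blast
  have "\<pi> \<cdot> (s \<cdot> \<pi>) = (\<pi> \<cdot> proj c) \<cdot> end0 c" "\<pi> \<cdot> Id M N = (\<pi> \<cdot> proj c) \<cdot> end1 c"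
    using reassoc[OF s(2), of \<pi>] s \<pi> cD by (simp_all add: hom_def)
  then obtain l where "l \<in> hom M (Dom M (proj c)) N" "l \<cdot> end0 c = s \<cdot> \<pi>" "l \<cdot> end1 c = Id M N"
    using cylinder_lift[OF c \<pi>(2,1) s\<pi> IdN b] by blast
  then have "homotopic M (s \<cdot> \<pi>) (Id M N)"
    unfolding homotopic_def is_homotopy_def using s\<pi> IdN c by blast
  then have "homotopic M (\<xi> \<cdot> (s \<cdot> \<pi>)) (\<xi> \<cdot> Id M N)"
    by (rule homotopic_comp_left[OF _ s\<pi> \<xi>(1)])
  then have "homotopic M ((\<xi> \<cdot> (s \<cdot> \<pi>)) \<cdot> i) ((\<xi> \<cdot> Id M N) \<cdot> i)"
    by (rule homotopic_comp_right[OF N Y E _ _ i(1), rotated 2])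
      (use \<xi> s\<pi> IdN in \<open>auto simp: hom_def\<close>)
  moreover have "(\<xi> \<cdot> (s \<cdot> \<pi>)) \<cdot> i = (\<xi> \<cdot> s) \<cdot> w" "(\<xi> \<cdot> Id M N) \<cdot> i = z"
    using \<xi> s \<pi> i by (auto simp: hom_def)
  moreover have "\<xi> \<cdot> s \<in> hom M P Y" using \<xi> s by (auto simp: hom_def)
  ultimately show ?thesis by auto
qed

lemma Weq_cancel_homotopic:
  assumes w: "w \<in> hom M E P" "w \<in> Weq M" and E: "cofibrant M E" and P: "cofibrant M P"
    and Y: "fibrant M Y" and f: "f \<in> hom M P Y" and g: "g \<in> hom M P Y"
    and fg: "homotopic M (f \<cdot> w) (g \<cdot> w)"
  shows "homotopic M f g"
proof -
  obtain N i \<pi> s where i: "i \<in> hom M E N" "i \<in> Cof M \<inter> Weq M"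
    and \<pi>: "\<pi> \<in> hom M N P" "\<pi> \<in> Fib M \<inter> Weq M" "\<pi> \<cdot> i = w"
    and s: "s \<in> hom M P N" "\<pi> \<cdot> s = Id M P"
    using Weq_factor_section[OF w P] by blast
  obtain q where q: "path_object M Y q" using path_object_exists fibrant_Obj[OF Y] by blast
  have fw: "f \<cdot> w \<in> hom M E Y" "g \<cdot> w \<in> hom M E Y" using f g w by (auto simp: hom_def)
  obtain r where r: "r \<in> hom M E (Cod M (proj q))" "end0 q \<cdot> r = f \<cdot> w" "end1 q \<cdot> r = g \<cdot> w"
    by (rule right_homotopyE[OF E Y fg fw q])
  have b: "f \<cdot> \<pi> \<in> hom M N Y" "g \<cdot> \<pi> \<in> hom M N Y" using f g \<pi> by (auto simp: hom_def)
  have "(f \<cdot> \<pi>) \<cdot> i = end0 q \<cdot> r" "(g \<cdot> \<pi>) \<cdot> i = end1 q \<cdot> r"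
    using f g \<pi> i r by (simp_all add: hom_def)
  then obtain l where l: "l \<in> hom M N (Cod M (proj q))" "end0 q \<cdot> l = f \<cdot> \<pi>" "end1 q \<cdot> l = g \<cdot> \<pi>"
    using path_lift[OF q i(2,1) b r(1)] by blast
  show ?thesis
    unfolding homotopic_iff_right[OF P Y q f g]
    by (rule bexI[of _ "l \<cdot> s"])
      (use path_objectD[OF q] l s f g \<pi> reassoc[OF l(2), of s] reassoc[OF l(3), of s]
        in \<open>auto simp: hom_def\<close>)
qed

end

section \<open>Double mapping cylinders\<close>

lemma double_mapping_cylinder_op_op [simp]:
  "double_mapping_cylinder (op_cat (op_cat M)) u v c E a e b =
   double_mapping_cylinder M u v c E a e b"
  by (simp add: double_mapping_cylinder_def)

context closed_model_category
begin

text \<open>The iterated pullback is taken as one limit, with \<open>Y\<close> occurring once for each end of the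
  path.\<close>

lemma double_mapping_path_exists:
  assumes r: "r \<in> hom M U Y" and s: "s \<in> hom M V Y" and q: "path_object M Y q"
  shows "\<exists>E a e b. double_mapping_path M r s q E a e b"
proof -
  let ?P = "Cod M (proj q)"
  let ?ds = "[U, ?P, V, Y, Y]"
  let ?es = "[(0, 3, r), (1, 3, end0 q), (1, 4, end1 q), (2, 4, s)]"
  note qD = path_objectD[OF q]
  have d: "Dom M r = U" "Dom M s = V" "Cod M r = Y" "Cod M s = Y" using r s by (auto simp: hom_def)
  have "finite_diagram M ?ds ?es"
    using r s qD hom_Obj[OF r] hom_Obj[OF s] hom_Obj[OF qD(1)] by (simp add: finite_diagram_def)
  then obtain E l where L: "is_limit M ?ds ?es E l"
    using limits unfolding has_finite_limits_def by blast
  then have l: "l 0 \<in> hom M E U" "l 1 \<in> hom M E ?P" "l 2 \<in> hom M E V"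
    "r \<cdot> l 0 = l 3" "end0 q \<cdot> l 1 = l 3" "end1 q \<cdot> l 1 = l 4" "s \<cdot> l 2 = l 4"
    by (simp_all add: is_limit_def is_cone_def all_less_5 numeral_2_eq_2)
  have "double_mapping_path M r s q E (l 0) (l 1) (l 2)"
    unfolding double_mapping_cylinder_def op_cat_simps hom_op_cat d
  proof (intro conjI allI ballI impI)
    show "l 0 \<in> hom M E U" "l 1 \<in> hom M E ?P" "l 2 \<in> hom M E V"
      "end0 q \<cdot> l 1 = r \<cdot> l 0" "end1 q \<cdot> l 1 = s \<cdot> l 2"
      using l by simp_all
    fix T a e b
    assume a: "a \<in> hom M T U" and e: "e \<in> hom M T ?P" and b: "b \<in> hom M T V"
      and ea: "end0 q \<cdot> e = r \<cdot> a" and eb: "end1 q \<cdot> e = s \<cdot> b"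
    let ?t = "\<lambda>i. if i = 0 then a else if i = 1 then e else if i = 2 then b
      else if i = 3 then r \<cdot> a else s \<cdot> b"
    have "r \<cdot> a \<in> hom M T Y" "s \<cdot> b \<in> hom M T Y" using a b r s by (auto simp: hom_def)
    then have "is_cone M ?ds ?es T ?t"
      using a b e ea eb hom_Obj(1)[OF a] by (simp add: is_cone_def all_less_5)
    then have "\<exists>!w. w \<in> hom M T E \<and> (\<forall>i < length ?ds. l i \<cdot> w = ?t i)"
      using L[unfolded is_limit_def] by blast
    moreover have "l 3 \<cdot> w = r \<cdot> a" if "w \<in> hom M T E" "l 0 \<cdot> w = a" for w
      using reassoc[of r "l 0" "l 3" w] l r that by (auto simp: hom_def)
    moreover have "l 4 \<cdot> w = s \<cdot> b" if "w \<in> hom M T E" "l 2 \<cdot> w = b" for w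
      using reassoc[of s "l 2" "l 4" w] l s that by (auto simp: hom_def)
    ultimately show "\<exists>!w. w \<in> hom M T E \<and> l 0 \<cdot> w = a \<and> l 1 \<cdot> w = e \<and> l 2 \<cdot> w = b"
      by (simp add: all_less_5 eval_nat_numeral cong: conj_cong)
  qed
  then show ?thesis by blast
qed

lemma double_mapping_cylinder_exists:
  assumes "u \<in> hom M W U" and "v \<in> hom M W V" and "cylinder M W c"
  shows "\<exists>E a e b. double_mapping_cylinder M u v c E a e b"
  using closed_model_category.double_mapping_path_exists[OF op_model, of u U W v V c] assms
  by simp

lemma double_mapping_cylinderD:
  assumes "double_mapping_cylinder M u v c E a e b" and "u \<in> hom M W U" and "v \<in> hom M W V"
  shows "a \<in> hom M U E" and "e \<in> hom M (Dom M (proj c)) E" and "b \<in> hom M V E"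
    and "e \<cdot> end0 c = a \<cdot> u" and "e \<cdot> end1 c = b \<cdot> v"
  using assms by (auto simp: double_mapping_cylinder_def hom_def)

lemma double_mapping_cylinder_map:
  assumes "double_mapping_cylinder M u v c E a e b" and "u \<in> hom M W U" and "v \<in> hom M W V"
    and "a' \<in> hom M U T" and "e' \<in> hom M (Dom M (proj c)) T" and "b' \<in> hom M V T"
    and "e' \<cdot> end0 c = a' \<cdot> u" and "e' \<cdot> end1 c = b' \<cdot> v"
  shows "\<exists>w \<in> hom M E T. w \<cdot> a = a' \<and> w \<cdot> e = e' \<and> w \<cdot> b = b'"
proof -
  have "Cod M u = U" "Cod M v = V" using assms(2,3) by (auto simp: hom_def)
  then show ?thesis using assms unfolding double_mapping_cylinder_def by blast
qed

lemma double_mapping_cylinder_ext: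
  assumes E: "double_mapping_cylinder M u v c E a e b"
    and u: "u \<in> hom M W U" and v: "v \<in> hom M W V" and c: "cylinder M W c"
    and w: "w \<in> hom M E T" and w': "w' \<in> hom M E T"
    and eq: "w \<cdot> a = w' \<cdot> a" "w \<cdot> e = w' \<cdot> e" "w \<cdot> b = w' \<cdot> b"
  shows "w = w'"
proof -
  note D = double_mapping_cylinderD[OF E u v] and cD = cylinderD[OF c]
  have d: "Cod M u = U" "Cod M v = V" using u v by (auto simp: hom_def)
  have m: "w' \<cdot> a \<in> hom M U T" "w' \<cdot> e \<in> hom M (Dom M (proj c)) T" "w' \<cdot> b \<in> hom M V T"
    using D w' by (auto simp: hom_def)
  have "(w' \<cdot> e) \<cdot> end0 c = (w' \<cdot> a) \<cdot> u" "(w' \<cdot> e) \<cdot> end1 c = (w' \<cdot> b) \<cdot> v"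
    using D w' cD u v by (simp_all add: hom_def)
  then have "\<exists>!x. x \<in> hom M E T \<and> x \<cdot> a = w' \<cdot> a \<and> x \<cdot> e = w' \<cdot> e \<and> x \<cdot> b = w' \<cdot> b"
    using E m unfolding double_mapping_cylinder_def d by blast
  then show ?thesis using w w' eq by blast
qed

text \<open>The inclusions of \<open>U\<close> and \<open>V\<close> together form a cofibration, because they are the pushout of
  the two ends of the cylinder on \<open>W\<close>. As for cylinders, they are kept apart.\<close>

lemma double_mapping_cylinder_lift:
  assumes E: "double_mapping_cylinder M u v c E a e b"
    and u: "u \<in> hom M W U" and v: "v \<in> hom M W V" and c: "cylinder M W c"
    and p: "p \<in> Fib M \<inter> Weq M" "p \<in> hom M A B"
    and a0: "a0 \<in> hom M U A" and b0: "b0 \<in> hom M V A" and y: "y \<in> hom M E B"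
    and ea: "p \<cdot> a0 = y \<cdot> a" and eb: "p \<cdot> b0 = y \<cdot> b"
  shows "\<exists>l \<in> hom M E A. l \<cdot> a = a0 \<and> l \<cdot> b = b0 \<and> p \<cdot> l = y"
proof -
  note D = double_mapping_cylinderD[OF E u v] and cD = cylinderD[OF c]
  have x: "a0 \<cdot> u \<in> hom M W A" "b0 \<cdot> v \<in> hom M W A" "y \<cdot> e \<in> hom M (Dom M (proj c)) B"
    using a0 b0 y D u v by (auto simp: hom_def)
  have "p \<cdot> (a0 \<cdot> u) = (y \<cdot> e) \<cdot> end0 c"
    using reassoc[OF ea, of u] p a0 u y D cD by (simp add: hom_def)
  moreover have "p \<cdot> (b0 \<cdot> v) = (y \<cdot> e) \<cdot> end1 c"
    using reassoc[OF eb, of v] p b0 v y D cD by (simp add: hom_def)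
  ultimately obtain k where k: "k \<in> hom M (Dom M (proj c)) A" "k \<cdot> end0 c = a0 \<cdot> u"
    "k \<cdot> end1 c = b0 \<cdot> v" "p \<cdot> k = y \<cdot> e"
    using cylinder_lift[OF c p x] by blast
  obtain l where l: "l \<in> hom M E A" "l \<cdot> a = a0" "l \<cdot> e = k" "l \<cdot> b = b0"
    using double_mapping_cylinder_map[OF E u v a0 k(1) b0 k(2,3)] by blast
  have "p \<cdot> l = y"
    by (rule double_mapping_cylinder_ext[OF E u v c])
      (use p l y D ea eb k(4) in \<open>auto simp: hom_def\<close>)
  then show ?thesis using l by blast
qed

lemma double_mapping_cylinder_cofibrant:
  assumes E: "double_mapping_cylinder M u v c E a e b"
    and u: "u \<in> hom M W U" and v: "v \<in> hom M W V" and c: "cylinder M W c"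
    and U: "cofibrant M U" and V: "cofibrant M V"
  shows "cofibrant M E"
  unfolding cofibrant_iff_lifting
proof (intro conjI ballI)
  note D = double_mapping_cylinderD[OF E u v]
  show "E \<in> Obj M" using hom_Obj(2)[OF D(1)] .
  fix p y
  assume p: "p \<in> Fib M \<inter> Weq M" and y: "y \<in> hom M E (Cod M p)"
  have pA: "p \<in> hom M (Dom M p) (Cod M p)" using p Fib_Arr by (auto simp: hom_def)
  have x: "y \<cdot> a \<in> hom M U (Cod M p)" "y \<cdot> b \<in> hom M V (Cod M p)" using y D by (auto simp: hom_def)
  obtain a0 b0 where "a0 \<in> hom M U (Dom M p)" "p \<cdot> a0 = y \<cdot> a"
    "b0 \<in> hom M V (Dom M p)" "p \<cdot> b0 = y \<cdot> b"
    using cofibrant_lift[OF U p pA x(1)] cofibrant_lift[OF V p pA x(2)] by blast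
  then show "\<exists>l \<in> hom M E (Dom M p). p \<cdot> l = y"
    using double_mapping_cylinder_lift[OF E u v c p pA _ _ y] by blast
qed

lemma double_mapping_path_fibrant:
  assumes "double_mapping_path M r s q E a e b"
    and "r \<in> hom M U Y" and "s \<in> hom M V Y" and "path_object M Y q"
    and "fibrant M U" and "fibrant M V"
  shows "fibrant M E"
  using closed_model_category.double_mapping_cylinder_cofibrant[OF op_model assms(1), of Y U V]
    assms by simp

lemma double_mapping_pathD:
  assumes "double_mapping_path M r s q E a e b" and "r \<in> hom M U Y" and "s \<in> hom M V Y"
  shows "a \<in> hom M E U" and "e \<in> hom M E (Cod M (proj q))" and "b \<in> hom M E V"
    and "end0 q \<cdot> e = r \<cdot> a" and "end1 q \<cdot> e = s \<cdot> b"
  using closed_model_category.double_mapping_cylinderD[OF op_model assms(1), of Y U V] assms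
  by simp_all

lemma double_mapping_path_map:
  assumes "double_mapping_path M r s q E a e b" and "r \<in> hom M U Y" and "s \<in> hom M V Y"
    and "a' \<in> hom M T U" and "e' \<in> hom M T (Cod M (proj q))" and "b' \<in> hom M T V"
    and "end0 q \<cdot> e' = r \<cdot> a'" and "end1 q \<cdot> e' = s \<cdot> b'"
  shows "\<exists>w \<in> hom M T E. a \<cdot> w = a' \<and> e \<cdot> w = e' \<and> b \<cdot> w = b'"
  using closed_model_category.double_mapping_cylinder_map[OF op_model assms(1), of Y U V a' T e' b']
    assms by simp

end

section \<open>Homotopy pullbacks and pushouts\<close>

text \<open>The strict form of the weak universal property of a homotopy pullback: a homotopy with
  cofibrant source is equal, not just homotopic, to a restriction of \<open>h\<close>. The restriction is along
  \<open>t\<close>, which agrees with \<open>w\<close> on the ends of the cylinders.\<close>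

definition universal_hsquare ::
  "('o, 'a, 'x) modcat_scheme \<Rightarrow> 'a \<Rightarrow> 'a \<Rightarrow> 'a \<Rightarrow> 'a \<Rightarrow> 'a cyl \<Rightarrow> 'a \<Rightarrow> bool" where
  "universal_hsquare M u v r s c h \<longleftrightarrow>
     (\<forall>W d k. \<forall>a \<in> hom M W (Dom M r). \<forall>b \<in> hom M W (Dom M s).
        cofibrant M W \<longrightarrow> is_homotopy M W (Cod M r) d k (r \<cdot>\<^bsub>M\<^esub> a) (s \<cdot>\<^bsub>M\<^esub> b) \<longrightarrow>
        (\<exists>w \<in> hom M W (Dom M u). \<exists>t \<in> hom M (Dom M (proj d)) (Dom M (proj c)).
           u \<cdot>\<^bsub>M\<^esub> w = a \<and> v \<cdot>\<^bsub>M\<^esub> w = b \<and>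
           t \<cdot>\<^bsub>M\<^esub> end0 d = end0 c \<cdot>\<^bsub>M\<^esub> w \<and> t \<cdot>\<^bsub>M\<^esub> end1 d = end1 c \<cdot>\<^bsub>M\<^esub> w \<and> h \<cdot>\<^bsub>M\<^esub> t = k))"

context closed_model_category
begin

lemma bifibrantD: "bifibrant M X \<Longrightarrow> fibrant M X" "bifibrant M X \<Longrightarrow> cofibrant M X"
  by (simp_all add: bifibrant_def)

text \<open>The other half of Quillen's correspondence, from left to right homotopies: \<open>K\<close> restricts at
  \<open>end0 d\<close> to the right homotopy that corresponds to \<open>k\<close>.\<close>

lemma double_homotopy_from_left:
  assumes W: "cofibrant M W" and q: "path_object M Y q" and k: "is_homotopy M W Y d k f g"
  shows "\<exists>K \<in> hom M (Dom M (proj d)) (Cod M (proj q)). end0 q \<cdot> K = k \<and>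
    end1 q \<cdot> K = g \<cdot> proj d \<and> K \<cdot> end1 d = proj q \<cdot> g"
proof -
  note kD = is_homotopyD[OF k] and qD = path_objectD[OF q]
  note dD = cylinderD[OF kD(3)]
  have b: "g \<cdot> proj d \<in> hom M (Dom M (proj d)) Y" "proj q \<cdot> g \<in> hom M W (Cod M (proj q))"
    using kD(2) dD qD by (auto simp: hom_def)
  have "k \<cdot> end1 d = end0 q \<cdot> (proj q \<cdot> g)" "(g \<cdot> proj d) \<cdot> end1 d = end1 q \<cdot> (proj q \<cdot> g)"
    using kD dD qD reassoc[OF qD(5), of g] reassoc[OF qD(6), of g] by (simp_all add: hom_def)
  then show ?thesis
    using path_lift[OF q cylinder_end1[OF W kD(3)] dD(3) kD(4) b] by blast
qed

text \<open>A cofibrant replacement \<open>F\<close> of the double mapping path object receives a map from every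
  cofibrant object which maps to that path object, so a right homotopy on \<open>W\<close> is always, strictly,
  the restriction of the tautological right homotopy \<open>r\<close> on \<open>F\<close>. For left homotopies to restrict
  strictly as well, the cylinder on \<open>F\<close> has to be chosen with care. A left homotopy on \<open>W\<close> and its
  right counterpart are two sides of a double homotopy \<open>K'\<close>, which starts at the right homotopy
  and ends at a constant one. The cylinder is built over the object \<open>B\<close> of pairs of a point of \<open>F\<close>
  and a path that ends where the path of that point ends; then \<open>K'\<close> is a map from the cylinder on
  \<open>W\<close> to \<open>B\<close>, and it lifts to the cylinder on \<open>F\<close>.\<close>

lemma hpullback_exists:
  assumes A: "bifibrant M A" and G: "bifibrant M G" and C: "bifibrant M C"
    and \<iota>: "\<iota> \<in> hom M A C" and g: "g \<in> hom M G C"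
  shows "\<exists>\<eta> \<beta> c h. hpullback M \<eta> \<beta> \<iota> g c h \<and> universal_hsquare M \<eta> \<beta> \<iota> g c h"
proof -
  obtain q where q: "path_object M C q"
    using path_object_exists hom_Obj(2)[OF g] by blast
  note qD = path_objectD[OF q]
  let ?P = "Cod M (proj q)"
  obtain E a e b where E: "double_mapping_path M \<iota> g q E a e b"
    using double_mapping_path_exists[OF \<iota> g q] by blast
  note ED = double_mapping_pathD[OF E \<iota> g]
  obtain F w where F: "cofibrant M F" and w: "w \<in> hom M F E" "w \<in> Fib M \<inter> Weq M"
    using cofibrant_replacement[OF hom_Obj(1)[OF ED(1)]] by blast
  have "fibrant M E"
    using double_mapping_path_fibrant[OF E \<iota> g q] A G by (simp add: bifibrant_def)
  then have bF: "bifibrant M F"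
    using fibrant_if_trivial_Fib[of E w F] w F by (simp add: bifibrant_def)
  have FO: "F \<in> Obj M" using hom_Obj(1)[OF w(1)] .
  define \<eta> \<beta> r where "\<eta> = a \<cdot> w" and "\<beta> = b \<cdot> w" and "r = e \<cdot> w"
  have maps: "\<eta> \<in> hom M F A" "\<beta> \<in> hom M F G" "r \<in> hom M F ?P"
    using w(1) ED by (auto simp: \<eta>_def \<beta>_def r_def hom_def)
  have r: "end0 q \<cdot> r = \<iota> \<cdot> \<eta>" "end1 q \<cdot> r = g \<cdot> \<beta>"
    unfolding \<eta>_def \<beta>_def r_def
    using reassoc[OF ED(4), of w] reassoc[OF ED(5), of w] ED w(1) qD \<iota> g
    by (simp_all add: hom_def)
  have g\<beta>: "g \<cdot> \<beta> \<in> hom M F C" using g maps by (auto simp: hom_def)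
  \<comment> \<open>the object over which the cylinder on \<open>F\<close> is built\<close>
  obtain B pB qB where B: "is_pullback M (g \<cdot> \<beta>) (end1 q) B pB qB"
    using pullback_exists[OF g\<beta> qD(3)] by blast
  have dB: "Dom M (g \<cdot> \<beta>) = F" "Dom M (end1 q) = ?P" using g\<beta> qD by (auto simp: hom_def)
  have BD: "pB \<in> hom M B F" "qB \<in> hom M B ?P" "(g \<cdot> \<beta>) \<cdot> pB = end1 q \<cdot> qB"
    using B unfolding is_pullback_def dB by simp_all
  have pB: "pB \<in> Fib M \<inter> Weq M"
    by (rule pullback_trivial_Fib[OF B g\<beta> qD(3) path_end1[OF bifibrantD(1)[OF C] q]])
  have st: "proj q \<cdot> (g \<cdot> \<beta>) \<in> hom M F ?P" using qD g\<beta> by (auto simp: hom_def)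
  have e: "(g \<cdot> \<beta>) \<cdot> Id M F = end1 q \<cdot> r" "(g \<cdot> \<beta>) \<cdot> Id M F = end1 q \<cdot> (proj q \<cdot> (g \<cdot> \<beta>))"
    using r g\<beta> qD(1,3) reassoc[OF qD(6), of "g \<cdot> \<beta>"] by (simp_all add: hom_def)
  obtain s0 where s0: "s0 \<in> hom M F B" "pB \<cdot> s0 = Id M F" "qB \<cdot> s0 = r"
    using pullback_map[OF B g\<beta> qD(3) Id_closed[OF FO] maps(3) e(1)] by blast
  obtain s1 where s1: "s1 \<in> hom M F B" "pB \<cdot> s1 = Id M F" "qB \<cdot> s1 = proj q \<cdot> (g \<cdot> \<beta>)"
    using pullback_map[OF B g\<beta> qD(3) Id_closed[OF FO] st e(2)] by blast
  obtain c t where c: "cylinder M F c" and t: "t \<in> hom M (Dom M (proj c)) B" "t \<in> Fib M \<inter> Weq M"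
    "t \<cdot> end0 c = s0" "t \<cdot> end1 c = s1" "pB \<cdot> t = proj c"
    using cylinder_over[OF FO pB BD(1) s0(1,2) s1(1,2)] by blast
  note cD = cylinderD[OF c]
  \<comment> \<open>the double homotopy on \<open>F\<close> between \<open>h\<close> and \<open>r\<close>\<close>
  define K where "K = qB \<cdot> t"
  define h where "h = end0 q \<cdot> K"
  have Kh: "K \<in> hom M (Dom M (proj c)) ?P" "h \<in> hom M (Dom M (proj c)) C"
    using BD t qD by (auto simp: K_def h_def hom_def)
  have K: "K \<cdot> end0 c = r" "K \<cdot> end1 c = proj q \<cdot> (g \<cdot> \<beta>)" "end1 q \<cdot> K = (g \<cdot> \<beta>) \<cdot> proj c"
  proof -
    show "K \<cdot> end0 c = r" "K \<cdot> end1 c = proj q \<cdot> (g \<cdot> \<beta>)"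
      unfolding K_def using BD t s0(3) s1(3) cD by (simp_all add: hom_def)
    have "end1 q \<cdot> K = ((g \<cdot> \<beta>) \<cdot> pB) \<cdot> t"
      unfolding K_def BD(3) using comp_assoc[of t qB "end1 q"] BD(1,2) t(1) qD(3) by (simp add: hom_def)
    also have "\<dots> = (g \<cdot> \<beta>) \<cdot> proj c"
      unfolding t(5)[symmetric] using comp_assoc[of t pB "g \<cdot> \<beta>"] BD(1) t(1) g\<beta> by (simp add: hom_def)
    finally show "end1 q \<cdot> K = (g \<cdot> \<beta>) \<cdot> proj c" .
  qed
  have h: "h \<cdot> end0 c = \<iota> \<cdot> \<eta>" "h \<cdot> end1 c = g \<cdot> \<beta>"
    using comp_assoc[of "end0 c" K "end0 q"] comp_assoc[of "end1 c" K "end0 q"]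
      reassoc[OF qD(5), of "g \<cdot> \<beta>"] K r Kh cD qD g\<beta>
    unfolding h_def by (simp_all add: hom_def)
  have ih: "is_homotopy M F C c h (\<iota> \<cdot> \<eta>) (g \<cdot> \<beta>)"
    unfolding is_homotopy_def using h Kh c maps \<iota> g by (auto simp: hom_def)
  have sq: "hsquare M \<eta> \<beta> \<iota> g c h"
    unfolding hsquare_def using bF A G C maps \<iota> g ih by blast
  have co: "corresponding M c q h r"
    unfolding corresponding_def h(2) using K Kh h_def by blast
  have d: "Dom M \<eta> = F" "Cod M \<iota> = C" "Dom M \<iota> = A" "Dom M g = G"
    using maps \<iota> g by (auto simp: hom_def)
  have "hpullback M \<eta> \<beta> \<iota> g c h"
    unfolding hpullback_def d using sq q co E w \<eta>_def \<beta>_def r_def by blast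
  moreover have "universal_hsquare M \<eta> \<beta> \<iota> g c h"
    unfolding universal_hsquare_def d
  proof (intro allI ballI impI)
    fix W d k a' b'
    assume a': "a' \<in> hom M W A" and b': "b' \<in> hom M W G" and W: "cofibrant M W"
      and k: "is_homotopy M W C d k (\<iota> \<cdot> a') (g \<cdot> b')"
    note kD = is_homotopyD[OF k]
    note dD = cylinderD[OF kD(3)]
    obtain K' where K': "K' \<in> hom M (Dom M (proj d)) ?P" "end0 q \<cdot> K' = k"
      "end1 q \<cdot> K' = (g \<cdot> b') \<cdot> proj d" "K' \<cdot> end1 d = proj q \<cdot> (g \<cdot> b')"
      using double_homotopy_from_left[OF W q k] by blast
    have k0: "K' \<cdot> end0 d \<in> hom M W ?P" using K'(1) dD by (auto simp: hom_def)
    have k0e: "end0 q \<cdot> (K' \<cdot> end0 d) = \<iota> \<cdot> a'" "end1 q \<cdot> (K' \<cdot> end0 d) = g \<cdot> b'"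
      using reassoc[OF K'(2), of "end0 d"] reassoc[OF K'(3), of "end0 d"] K'(1) dD qD kD
      by (simp_all add: hom_def)
    obtain x where x: "x \<in> hom M W E" "a \<cdot> x = a'" "e \<cdot> x = K' \<cdot> end0 d" "b \<cdot> x = b'"
      using double_mapping_path_map[OF E \<iota> g a' k0 b' k0e] by blast
    obtain \<tau> where \<tau>: "\<tau> \<in> hom M W F" "w \<cdot> \<tau> = x"
      using cofibrant_lift[OF W w(2,1) x(1)] by blast
    have \<tau>e: "\<eta> \<cdot> \<tau> = a'" "\<beta> \<cdot> \<tau> = b'" "r \<cdot> \<tau> = K' \<cdot> end0 d"
      unfolding \<eta>_def \<beta>_def r_def using ED w(1) \<tau> x by (simp_all add: hom_def)
    have \<tau>d: "\<tau> \<cdot> proj d \<in> hom M (Dom M (proj d)) F" using \<tau>(1) dD by (auto simp: hom_def)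
    have g\<beta>\<tau>: "(g \<cdot> \<beta>) \<cdot> \<tau> = g \<cdot> b'" using g maps \<tau>(1) \<tau>e by (simp add: hom_def)
    have "(g \<cdot> \<beta>) \<cdot> (\<tau> \<cdot> proj d) = end1 q \<cdot> K'"
      unfolding K'(3) g\<beta>\<tau>[symmetric]
      using comp_assoc[of "proj d" \<tau> "g \<cdot> \<beta>"] g\<beta> \<tau>(1) dD by (simp add: hom_def)
    \<comment> \<open>\<open>K'\<close> as a map to \<open>B\<close>; its lift \<open>n\<close> to the cylinder satisfies \<open>K \<cdot> n = K'\<close>\<close>
    then obtain m where m: "m \<in> hom M (Dom M (proj d)) B" "pB \<cdot> m = \<tau> \<cdot> proj d" "qB \<cdot> m = K'"
      using pullback_map[OF B g\<beta> qD(3) \<tau>d K'(1)] by blast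
    have x0: "end0 c \<cdot> \<tau> \<in> hom M W (Dom M (proj c))" and x1: "end1 c \<cdot> \<tau> \<in> hom M W (Dom M (proj c))"
      using cD \<tau>(1) by (auto simp: hom_def)
    have y0: "t \<cdot> (end0 c \<cdot> \<tau>) = m \<cdot> end0 d"
    proof (rule pullback_ext[OF B g\<beta> qD(3)])
      have *: "t \<cdot> (end0 c \<cdot> \<tau>) = s0 \<cdot> \<tau>"
        using reassoc[OF t(3), of \<tau>] t(1) cD \<tau>(1) by (simp add: hom_def)
      show "t \<cdot> (end0 c \<cdot> \<tau>) \<in> hom M W B" "m \<cdot> end0 d \<in> hom M W B"
        using t(1) x0 m(1) dD by (auto simp: hom_def)
      show "pB \<cdot> (t \<cdot> (end0 c \<cdot> \<tau>)) = pB \<cdot> (m \<cdot> end0 d)"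
        unfolding * using reassoc[OF s0(2), of \<tau>] reassoc[OF m(2), of "end0 d"] s0(1) m(1) BD(1)
          \<tau>(1) dD by (simp add: hom_def)
      show "qB \<cdot> (t \<cdot> (end0 c \<cdot> \<tau>)) = qB \<cdot> (m \<cdot> end0 d)"
        unfolding * using reassoc[OF s0(3), of \<tau>] reassoc[OF m(3), of "end0 d"] s0(1) m(1) BD(2)
          \<tau>(1) \<tau>e(3) dD by (simp add: hom_def)
    qed
    have y1: "t \<cdot> (end1 c \<cdot> \<tau>) = m \<cdot> end1 d"
    proof (rule pullback_ext[OF B g\<beta> qD(3)])
      have *: "t \<cdot> (end1 c \<cdot> \<tau>) = s1 \<cdot> \<tau>"
        using reassoc[OF t(4), of \<tau>] t(1) cD \<tau>(1) by (simp add: hom_def)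
      show "t \<cdot> (end1 c \<cdot> \<tau>) \<in> hom M W B" "m \<cdot> end1 d \<in> hom M W B"
        using t(1) x1 m(1) dD by (auto simp: hom_def)
      show "pB \<cdot> (t \<cdot> (end1 c \<cdot> \<tau>)) = pB \<cdot> (m \<cdot> end1 d)"
        unfolding * using reassoc[OF s1(2), of \<tau>] reassoc[OF m(2), of "end1 d"] s1(1) m(1) BD(1)
          \<tau>(1) dD by (simp add: hom_def)
      have "(proj q \<cdot> (g \<cdot> \<beta>)) \<cdot> \<tau> = proj q \<cdot> (g \<cdot> b')"
        unfolding g\<beta>\<tau>[symmetric]
        using comp_assoc[of \<tau> "g \<cdot> \<beta>" "proj q"] qD(1) g\<beta> \<tau>(1) by (simp add: hom_def)
      then show "qB \<cdot> (t \<cdot> (end1 c \<cdot> \<tau>)) = qB \<cdot> (m \<cdot> end1 d)"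
        unfolding * using reassoc[OF s1(3), of \<tau>] reassoc[OF m(3), of "end1 d"] s1(1) m(1) BD(2)
          \<tau>(1) K'(4) dD by (simp add: hom_def)
    qed
    obtain n where n: "n \<in> hom M (Dom M (proj d)) (Dom M (proj c))"
      "n \<cdot> end0 d = end0 c \<cdot> \<tau>" "n \<cdot> end1 d = end1 c \<cdot> \<tau>" "t \<cdot> n = m"
      using cylinder_lift[OF kD(3) t(2,1) x0 x1 m(1) y0 y1] by blast
    have "h \<cdot> n = k"
      unfolding h_def K_def using BD(2) t(1) qD(2) n(1,4) m(3) K'(2) by (simp add: hom_def)
    then show "\<exists>w \<in> hom M W F. \<exists>t \<in> hom M (Dom M (proj d)) (Dom M (proj c)).
        \<eta> \<cdot> w = a' \<and> \<beta> \<cdot> w = b' \<and> t \<cdot> end0 d = end0 c \<cdot> w \<and> t \<cdot> end1 d = end1 c \<cdot> w \<and> h \<cdot> t = k"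
      using n \<tau>(1) \<tau>e(1,2) by blast
  qed
  ultimately show ?thesis by blast
qed

lemma hsquareD:
  assumes "hsquare M u v r s c h"
  obtains W U V Y where "bifibrant M W" and "bifibrant M U" and "bifibrant M V" and "bifibrant M Y"
    and "u \<in> hom M W U" and "v \<in> hom M W V" and "r \<in> hom M U Y" and "s \<in> hom M V Y"
    and "is_homotopy M W Y c h (r \<cdot> u) (s \<cdot> v)"
  using assms unfolding hsquare_def by blast

text \<open>A fibrant replacement of the double mapping cylinder is a homotopy pushout, and maps from
  the double mapping cylinder to fibrant objects extend to it. Whisker maps out of this choice
  satisfy their equations strictly.\<close>

lemma hpushout_exists:
  assumes "hsquare M u v r' s' c h'"
  shows "\<exists>r s h w. hpushout M u v r s c h \<and> whisker M u v r s c h r' s' h' w \<and>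
    w \<cdot> r = r' \<and> w \<cdot> s = s' \<and> w \<cdot> h = h'"
proof -
  obtain W U V Y where bif: "bifibrant M W" "bifibrant M U" "bifibrant M V" "bifibrant M Y"
    and u: "u \<in> hom M W U" and v: "v \<in> hom M W V" and r': "r' \<in> hom M U Y" and s': "s' \<in> hom M V Y"
    and h': "is_homotopy M W Y c h' (r' \<cdot> u) (s' \<cdot> v)"
    using hsquareD[OF assms] .
  note hD = is_homotopyD[OF h']
  note c = hD(3) and cD = cylinderD[OF hD(3)]
  obtain E a e b where E: "double_mapping_cylinder M u v c E a e b"
    using double_mapping_cylinder_exists[OF u v c] by blast
  note ED = double_mapping_cylinderD[OF E u v]
  have EC: "cofibrant M E"
    using double_mapping_cylinder_cofibrant[OF E u v c] bif by (simp add: bifibrant_def)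
  obtain Q x where Q: "fibrant M Q" and x: "x \<in> hom M E Q" "x \<in> Cof M \<inter> Weq M"
    using fibrant_replacement[OF cofibrant_Obj[OF EC]] by blast
  have bQ: "bifibrant M Q" using Q cofibrant_if_Cof[OF EC _ x(1)] x by (simp add: bifibrant_def)
  obtain y where y: "y \<in> hom M E Y" "y \<cdot> a = r'" "y \<cdot> e = h'" "y \<cdot> b = s'"
    using double_mapping_cylinder_map[OF E u v r' hD(4) s' hD(5,6)] by blast
  obtain w where w: "w \<in> hom M Q Y" "w \<cdot> x = y"
    using fibrant_extend[OF bifibrantD(1)[OF bif(4)] x(2,1) y(1)] by blast
  have m: "x \<cdot> a \<in> hom M U Q" "x \<cdot> b \<in> hom M V Q" "x \<cdot> e \<in> hom M (Dom M (proj c)) Q"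
    using x(1) ED by (auto simp: hom_def)
  have d: "Cod M (x \<cdot> a) = Q" "Cod M r' = Y" using m r' by (auto simp: hom_def)
  have "is_homotopy M W Q c (x \<cdot> e) ((x \<cdot> a) \<cdot> u) ((x \<cdot> b) \<cdot> v)"
    unfolding is_homotopy_def using m x(1) ED u v c cD by (auto simp: hom_def)
  then have "hsquare M u v (x \<cdot> a) (x \<cdot> b) c (x \<cdot> e)"
    unfolding hsquare_def using bif bQ u v m by blast
  then have P: "hpushout M u v (x \<cdot> a) (x \<cdot> b) c (x \<cdot> e)"
    unfolding hpushout_def d using E x by blast
  have "homotopic M (w \<cdot> x) y"
    using homotopic_refl[OF EC bifibrantD(1)[OF bif(4)] y(1)] w by simp
  then have "whisker M u v (x \<cdot> a) (x \<cdot> b) c (x \<cdot> e) r' s' h' w"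
    unfolding whisker_def d using P assms w(1) E x(1) y by blast
  moreover have "w \<cdot> (x \<cdot> a) = r'" "w \<cdot> (x \<cdot> b) = s'" "w \<cdot> (x \<cdot> e) = h'"
    using reassoc[OF w(2), of a] reassoc[OF w(2), of b] reassoc[OF w(2), of e] w(1) x(1) ED y
    by (simp_all add: hom_def)
  ultimately show ?thesis using P by blast
qed

text \<open>The homotopy extension property of \<open>U + V \<rightarrow> E\<close>, by lifting against the trivial fibration
  \<open>end0 q\<close>.\<close>

lemma double_mapping_cylinder_homotopy_extension:
  assumes E: "double_mapping_cylinder M u v c E a e b"
    and u: "u \<in> hom M W U" and v: "v \<in> hom M W V" and c: "cylinder M W c"
    and U: "cofibrant M U" and V: "cofibrant M V" and Y: "fibrant M Y"
    and y: "y \<in> hom M E Y" and r: "r \<in> hom M U Y" and s: "s \<in> hom M V Y"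
    and yr: "homotopic M (y \<cdot> a) r" and ys: "homotopic M (y \<cdot> b) s"
  shows "\<exists>z \<in> hom M E Y. homotopic M y z \<and> z \<cdot> a = r \<and> z \<cdot> b = s"
proof -
  note D = double_mapping_cylinderD[OF E u v]
  obtain q where q: "path_object M Y q" using path_object_exists fibrant_Obj[OF Y] by blast
  note qD = path_objectD[OF q]
  have x: "y \<cdot> a \<in> hom M U Y" "y \<cdot> b \<in> hom M V Y" using y D by (auto simp: hom_def)
  obtain k where k: "k \<in> hom M U (Cod M (proj q))" "end0 q \<cdot> k = y \<cdot> a" "end1 q \<cdot> k = r"
    by (rule right_homotopyE[OF U Y yr x(1) r q])
  obtain l where l: "l \<in> hom M V (Cod M (proj q))" "end0 q \<cdot> l = y \<cdot> b" "end1 q \<cdot> l = s"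
    by (rule right_homotopyE[OF V Y ys x(2) s q])
  obtain H where H: "H \<in> hom M E (Cod M (proj q))" "H \<cdot> a = k" "H \<cdot> b = l" "end0 q \<cdot> H = y"
    using double_mapping_cylinder_lift[OF E u v c path_end0[OF Y q] qD(2) k(1) l(1) y k(2) l(2)]
    by blast
  have z: "end1 q \<cdot> H \<in> hom M E Y" using H(1) qD by (auto simp: hom_def)
  have "homotopic M y (end1 q \<cdot> H)"
    using homotopic_iff_right[OF double_mapping_cylinder_cofibrant[OF E u v c U V] Y q y z] H by blast
  moreover have "(end1 q \<cdot> H) \<cdot> a = r" "(end1 q \<cdot> H) \<cdot> b = s"
    using H D k l qD by (simp_all add: hom_def)
  ultimately show ?thesis using z by blast
qed

text \<open>On the pushout of \<open>U\<close> and \<open>V\<close> under \<open>W\<close>, the map \<open>p\<close> amounts to a homotopy on \<open>W\<close> between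
  \<open>\<iota> \<cdot> (a \<cdot> u)\<close> and \<open>g \<cdot> (b \<cdot> v)\<close>. Such a homotopy is a map from \<open>W\<close> to the homotopy pullback of
  \<open>\<iota>\<close> and \<open>g\<close>, which forms with \<open>a\<close> and \<open>b\<close> a map of pushout data; \<open>\<phi>\<close> is the map that it
  induces on homotopy pushouts. As homotopies on \<open>W\<close> are strict restrictions of \<open>h\<close>, and \<open>\<iota>\<close>, \<open>g\<close>
  and \<open>h\<close> are strict restrictions of \<open>g'\<close>, the squares commute strictly, and no higher
  homotopies appear.\<close>

lemma map_to_join:
  assumes FU: "universal_hsquare M \<eta> \<beta> \<iota> g c h" and F: "hsquare M \<eta> \<beta> \<iota> g c h"
    and J: "hsquare M \<eta> \<beta> \<alpha>' \<gamma> c l"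
    and g': "g' \<in> hom M (Cod M \<alpha>') (Cod M \<iota>)" "g' \<cdot> \<alpha>' = \<iota>" "g' \<cdot> \<gamma> = g" "g' \<cdot> l = h"
    and P: "hpushout M u v r s d k"
    and p: "p \<in> hom M (Cod M r) (Cod M \<iota>)"
    and a: "a \<in> hom M (Dom M r) (Dom M \<iota>)" and b: "b \<in> hom M (Dom M s) (Dom M g)"
    and pa: "homotopic M (p \<cdot> r) (\<iota> \<cdot> a)" and pb: "homotopic M (p \<cdot> s) (g \<cdot> b)"
  shows "\<exists>\<phi> \<in> hom M (Cod M r) (Cod M \<alpha>'). homotopic M (g' \<cdot> \<phi>) p \<and>
    homotopic M (\<phi> \<cdot> r) (\<alpha>' \<cdot> a)"
proof -
  obtain Fo A G C where bifF: "bifibrant M Fo" "bifibrant M A" "bifibrant M G" "bifibrant M C"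
    and \<eta>: "\<eta> \<in> hom M Fo A" and \<beta>: "\<beta> \<in> hom M Fo G" and \<iota>: "\<iota> \<in> hom M A C" and g: "g \<in> hom M G C"
    and h: "is_homotopy M Fo C c h (\<iota> \<cdot> \<eta>) (g \<cdot> \<beta>)"
    using hsquareD[OF F] .
  obtain Fo' A' G' Q where bifJ: "bifibrant M Q"
    and JD': "\<eta> \<in> hom M Fo' A'" "\<beta> \<in> hom M Fo' G'" "\<alpha>' \<in> hom M A' Q" "\<gamma> \<in> hom M G' Q"
    and l: "is_homotopy M Fo' Q c l (\<alpha>' \<cdot> \<eta>) (\<gamma> \<cdot> \<beta>)"
    using hsquareD[OF J] .
  have [simp]: "Fo' = Fo" "A' = A" "G' = G" using JD' \<eta> \<beta> by (auto simp: hom_def)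
  have JD: "\<alpha>' \<in> hom M A Q" "\<gamma> \<in> hom M G Q" using JD' by simp_all
  have "hsquare M u v r s d k" using P by (simp add: hpushout_def)
  then obtain W U V Y where bif: "bifibrant M W" "bifibrant M U" "bifibrant M V" "bifibrant M Y"
    and u: "u \<in> hom M W U" and v: "v \<in> hom M W V" and r: "r \<in> hom M U Y" and s: "s \<in> hom M V Y"
    and k: "is_homotopy M W Y d k (r \<cdot> u) (s \<cdot> v)"
    using hsquareD by blast
  have dom: "Cod M r = Y" "Dom M r = U" "Dom M s = V" "Cod M \<iota> = C" "Dom M \<iota> = A" "Dom M g = G"
    "Cod M \<alpha>' = Q" "Dom M \<eta> = Fo"
    using r s \<iota> g JD \<eta> by (auto simp: hom_def)
  note g' = g'[unfolded dom] and p = p[unfolded dom] and a = a[unfolded dom] and b = b[unfolded dom]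
  note cD = cylinderD[OF is_homotopyD(3)[OF h]]
  note lD = is_homotopyD[OF l, simplified] and hD = is_homotopyD[OF h]
  note d = is_homotopyD(3)[OF k]
  note dD = cylinderD[OF d]
  obtain E aE eE bE w where E: "double_mapping_cylinder M u v d E aE eE bE"
    and w: "w \<in> hom M E Y" "w \<cdot> aE = r" "w \<cdot> eE = k" "w \<cdot> bE = s" "w \<in> Weq M"
    using P unfolding hpushout_def dom by blast
  note ED = double_mapping_cylinderD[OF E u v]
  have EC: "cofibrant M E"
    using double_mapping_cylinder_cofibrant[OF E u v d] bif by (simp add: bifibrant_def)
  have pw: "p \<cdot> w \<in> hom M E C" and \<iota>a: "\<iota> \<cdot> a \<in> hom M U C" and gb: "g \<cdot> b \<in> hom M V C"
    using p w(1) \<iota> a g b by (auto simp: hom_def)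
  have "(p \<cdot> w) \<cdot> aE = p \<cdot> r" "(p \<cdot> w) \<cdot> bE = p \<cdot> s" using p w ED by (simp_all add: hom_def)
  \<comment> \<open>deform \<open>p\<close> on the double mapping cylinder until its restrictions to the corners factor strictly\<close>
  then obtain y where y: "y \<in> hom M E C" "homotopic M (p \<cdot> w) y" "y \<cdot> aE = \<iota> \<cdot> a" "y \<cdot> bE = g \<cdot> b"
    using double_mapping_cylinder_homotopy_extension[OF E u v d _ _ _ pw \<iota>a gb] pa pb bif bifF
    by (auto simp: bifibrant_def)
  have au: "a \<cdot> u \<in> hom M W A" and bv: "b \<cdot> v \<in> hom M W G" using a b u v by (auto simp: hom_def)
  have yu: "(\<iota> \<cdot> a) \<cdot> u = \<iota> \<cdot> (a \<cdot> u)" "(g \<cdot> b) \<cdot> v = g \<cdot> (b \<cdot> v)"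
    using \<iota> a u g b v by (simp_all add: hom_def)
  have "is_homotopy M W C d (y \<cdot> eE) (\<iota> \<cdot> (a \<cdot> u)) (g \<cdot> (b \<cdot> v))"
    unfolding is_homotopy_def
  proof (intro conjI)
    show "\<iota> \<cdot> (a \<cdot> u) \<in> hom M W C" "g \<cdot> (b \<cdot> v) \<in> hom M W C" "cylinder M W d"
      "y \<cdot> eE \<in> hom M (Dom M (proj d)) C"
      using \<iota> g au bv d y(1) ED by (auto simp: hom_def)
    show "(y \<cdot> eE) \<cdot> end0 d = \<iota> \<cdot> (a \<cdot> u)" "(y \<cdot> eE) \<cdot> end1 d = g \<cdot> (b \<cdot> v)"
      using y(1) ED dD u v reassoc[OF y(3), of u] reassoc[OF y(4), of v] yu
      by (simp_all add: hom_def)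
  qed
  then obtain \<tau> t where \<tau>: "\<tau> \<in> hom M W Fo" and t: "t \<in> hom M (Dom M (proj d)) (Dom M (proj c))"
    and \<tau>e: "\<eta> \<cdot> \<tau> = a \<cdot> u" "\<beta> \<cdot> \<tau> = b \<cdot> v"
    and te: "t \<cdot> end0 d = end0 c \<cdot> \<tau>" "t \<cdot> end1 d = end1 c \<cdot> \<tau>" "h \<cdot> t = y \<cdot> eE"
    using FU[unfolded universal_hsquare_def dom, rule_format, OF au bv bifibrantD(2)[OF bif(1)]]
    by blast
  have m: "\<alpha>' \<cdot> a \<in> hom M U Q" "l \<cdot> t \<in> hom M (Dom M (proj d)) Q" "\<gamma> \<cdot> b \<in> hom M V Q"
    using JD a b lD t by (auto simp: hom_def)
  have "(l \<cdot> t) \<cdot> end0 d = (\<alpha>' \<cdot> a) \<cdot> u" "(l \<cdot> t) \<cdot> end1 d = (\<gamma> \<cdot> b) \<cdot> v"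
    using lD(4) t te dD cD \<tau> JD \<eta> \<beta> a u b v \<tau>e reassoc[OF lD(5), of \<tau>] reassoc[OF lD(6), of \<tau>]
    by (simp_all add: hom_def)
  \<comment> \<open>the map of pushout data induced by \<open>a\<close>, \<open>\<tau>\<close> and \<open>b\<close>\<close>
  then obtain \<psi> where \<psi>: "\<psi> \<in> hom M E Q" "\<psi> \<cdot> aE = \<alpha>' \<cdot> a" "\<psi> \<cdot> eE = l \<cdot> t" "\<psi> \<cdot> bE = \<gamma> \<cdot> b"
    using double_mapping_cylinder_map[OF E u v m] by blast
  have g'\<psi>: "g' \<cdot> \<psi> = y"
  proof (rule double_mapping_cylinder_ext[OF E u v d])
    show "g' \<cdot> \<psi> \<in> hom M E C" "y \<in> hom M E C" using g' \<psi> y by (auto simp: hom_def)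
    show "(g' \<cdot> \<psi>) \<cdot> aE = y \<cdot> aE" "(g' \<cdot> \<psi>) \<cdot> bE = y \<cdot> bE" "(g' \<cdot> \<psi>) \<cdot> eE = y \<cdot> eE"
      using g'(1) \<psi> ED y(3,4) te(3) JD a b t lD(4) reassoc[OF g'(2), of a] reassoc[OF g'(3), of b]
        reassoc[OF g'(4), of t]
      by (simp_all add: hom_def)
  qed
  \<comment> \<open>carry \<open>\<psi>\<close> over to the given homotopy pushout\<close>
  obtain \<phi> where \<phi>: "\<phi> \<in> hom M Y Q" "homotopic M (\<phi> \<cdot> w) \<psi>"
    using Weq_extend[OF w(1,5) EC _ _ \<psi>(1)] bif bifJ by (auto simp: bifibrant_def)
  have \<phi>w: "\<phi> \<cdot> w \<in> hom M E Q" and g'\<phi>: "g' \<cdot> \<phi> \<in> hom M Y C"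
    using \<phi>(1) w(1) g'(1) by (auto simp: hom_def)
  have "homotopic M (g' \<cdot> (\<phi> \<cdot> w)) y"
    using homotopic_comp_left[OF \<phi>(2) \<phi>w g'(1)] g'\<psi> by simp
  moreover have *: "g' \<cdot> (\<phi> \<cdot> w) = (g' \<cdot> \<phi>) \<cdot> w" using g'(1) \<phi>(1) w(1) by (simp add: hom_def)
  moreover have "(g' \<cdot> \<phi>) \<cdot> w \<in> hom M E C" using g'\<phi> w(1) by (auto simp: hom_def)
  ultimately have "homotopic M ((g' \<cdot> \<phi>) \<cdot> w) (p \<cdot> w)"
    using homotopic_trans[OF EC bifibrantD(1)[OF bifF(4)] _ _ homotopic_sym[OF y(2)]] by simp
  then have "homotopic M (g' \<cdot> \<phi>) p"
    by (rule Weq_cancel_homotopic[OF w(1,5) EC bifibrantD(2)[OF bif(4)] bifibrantD(1)[OF bifF(4)]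
          g'\<phi> p])
  moreover have "homotopic M ((\<phi> \<cdot> w) \<cdot> aE) (\<psi> \<cdot> aE)"
    by (rule homotopic_comp_right[OF EC bifibrantD(1)[OF bifJ] bifibrantD(2)[OF bif(2)] \<phi>w \<psi>(1)
          ED(1) \<phi>(2)])
  then have "homotopic M (\<phi> \<cdot> r) (\<alpha>' \<cdot> a)"
    using \<phi>(1) w ED(1) \<psi>(2) by (simp add: hom_def)
  ultimately show ?thesis unfolding dom using \<phi>(1) by blast
qed

end

section \<open>The Ganea construction\<close>

context closed_model_category
begin

text \<open>A whisker map is characterised by its composite with a map out of the double mapping
  cylinder; only the two corners of that composite matter below.\<close>

lemma whisker_restrict:
  assumes w: "whisker M u v r s c h r' s' h' w"
  shows "homotopic M (w \<cdot> r) r'" and "homotopic M (w \<cdot> s) s'"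
proof -
  have "hsquare M u v r s c h" using w by (simp add: whisker_def hpushout_def)
  then obtain W U V P where bif: "bifibrant M W" "bifibrant M U" "bifibrant M V" "bifibrant M P"
    and u: "u \<in> hom M W U" and v: "v \<in> hom M W V" and r: "r \<in> hom M U P" and s: "s \<in> hom M V P"
    and h: "is_homotopy M W P c h (r \<cdot> u) (s \<cdot> v)"
    by (rule hsquareD)
  have "hsquare M u v r' s' c h'" using w by (simp add: whisker_def)
  then obtain U' Y where bY: "bifibrant M Y" and r': "r' \<in> hom M U' Y"
    by (rule hsquareD)
  have dom: "Cod M r = P" "Cod M r' = Y" using r r' by (auto simp: hom_def)
  obtain E a e b x y where wh: "w \<in> hom M P Y" and E: "double_mapping_cylinder M u v c E a e b"
    and x: "x \<in> hom M E P" "x \<cdot> a = r" "x \<cdot> b = s"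
    and y: "y \<in> hom M E Y" "y \<cdot> a = r'" "y \<cdot> b = s'" and H: "homotopic M (w \<cdot> x) y"
    using w unfolding whisker_def dom by blast
  note ED = double_mapping_cylinderD[OF E u v]
  have EC: "cofibrant M E"
    using double_mapping_cylinder_cofibrant[OF E u v is_homotopyD(3)[OF h]] bif
    by (simp add: bifibrant_def)
  have wx: "w \<cdot> x \<in> hom M E Y" using wh x(1) by (auto simp: hom_def)
  have "homotopic M ((w \<cdot> x) \<cdot> a) (y \<cdot> a)"
    by (rule homotopic_comp_right[OF EC bifibrantD(1)[OF bY] bifibrantD(2)[OF bif(2)] wx y(1)
          ED(1) H])
  moreover have "homotopic M ((w \<cdot> x) \<cdot> b) (y \<cdot> b)"
    by (rule homotopic_comp_right[OF EC bifibrantD(1)[OF bY] bifibrantD(2)[OF bif(3)] wx y(1)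
          ED(3) H])
  moreover have "(w \<cdot> x) \<cdot> a = w \<cdot> r" "(w \<cdot> x) \<cdot> b = w \<cdot> s"
    using wh x ED by (simp_all add: hom_def)
  ultimately show "homotopic M (w \<cdot> r) r'" "homotopic M (w \<cdot> s) s'" using y by simp_all
qed

text \<open>The next stage for \<open>\<iota>\<close> is chosen by \<open>hpullback_exists\<close> and \<open>hpushout_exists\<close>, so that
  \<open>map_to_join\<close> applies to it; \<open>ganea\<close> leaves this choice open.\<close>

lemma ganea_Suc_map:
  assumes A: "bifibrant M A" and C: "bifibrant M C" and G: "bifibrant M G"
    and \<iota>: "\<iota> \<in> hom M A C" and g: "g \<in> hom M G C" and ga: "ganea M \<iota> i g \<alpha>"
    and P: "hpushout M u v r s d k"
    and p: "p \<in> hom M (Cod M r) C" and a: "a \<in> hom M (Dom M r) A" and b: "b \<in> hom M (Dom M s) G"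
    and pa: "homotopic M (p \<cdot> r) (\<iota> \<cdot> a)" and pb: "homotopic M (p \<cdot> s) (g \<cdot> b)"
  shows "\<exists>Q. \<exists>g' \<in> hom M Q C. \<exists>\<alpha>' \<in> hom M A Q. \<exists>\<phi> \<in> hom M (Cod M r) Q. bifibrant M Q \<and>
    ganea M \<iota> (Suc i) g' \<alpha>' \<and> homotopic M (g' \<cdot> \<phi>) p \<and> homotopic M (\<phi> \<cdot> r) (\<alpha>' \<cdot> a)"
proof -
  obtain \<eta> \<beta> c h where F: "hpullback M \<eta> \<beta> \<iota> g c h" "universal_hsquare M \<eta> \<beta> \<iota> g c h"
    using hpullback_exists[OF A G C \<iota> g] by blast
  have sq: "hsquare M \<eta> \<beta> \<iota> g c h" using F(1) by (simp add: hpullback_def)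
  obtain \<alpha>' \<gamma> l g' where J: "hpushout M \<eta> \<beta> \<alpha>' \<gamma> c l" "whisker M \<eta> \<beta> \<alpha>' \<gamma> c l \<iota> g h g'"
    and e: "g' \<cdot> \<alpha>' = \<iota>" "g' \<cdot> \<gamma> = g" "g' \<cdot> l = h"
    using hpushout_exists[OF sq] by blast
  have jsq: "hsquare M \<eta> \<beta> \<alpha>' \<gamma> c l" using J(1) by (simp add: hpushout_def)
  have dom: "Cod M \<iota> = C" "Dom M \<iota> = A" "Dom M g = G" using \<iota> g by (auto simp: hom_def)
  note p' = p[folded dom(1)] and a' = a[folded dom(2)] and b' = b[folded dom(3)]
  have g': "g' \<in> hom M (Cod M \<alpha>') (Cod M \<iota>)" using J(2) by (simp add: whisker_def)
  have "bifibrant M (Cod M \<alpha>')" "\<alpha>' \<in> hom M A (Cod M \<alpha>')"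
    using jsq sq \<iota> unfolding hsquare_def hom_def by auto
  moreover have "ganea M \<iota> (Suc i) g' \<alpha>'" by (rule ganea_Suc[OF ga F(1) J])
  moreover obtain \<phi> where "\<phi> \<in> hom M (Cod M r) (Cod M \<alpha>')" "homotopic M (g' \<cdot> \<phi>) p"
    "homotopic M (\<phi> \<cdot> r) (\<alpha>' \<cdot> a)"
    using map_to_join[OF F(2) sq jsq g' e P p' a' b' pa pb] by blast
  ultimately show ?thesis using g'[unfolded dom] by blast
qed

text \<open>Naturality of the Ganea construction along \<open>\<chi>\<close>, up to homotopy. In the induction step
  \<open>\<chi> \<cdot> g1\<close> is lifted to the next stage for \<open>\<kappa>\<close>, since its restrictions to the corners lift: on \<open>A\<close>
  it is homotopic to \<open>\<kappa>\<close>, and on \<open>G\<^sub>i\<close> the previous stage supplies a lift. The stages for \<open>\<iota>\<close> are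
  arbitrary, those for \<open>\<kappa>\<close> are constructed along the way.\<close>

lemma ganea_map:
  assumes ga: "ganea M \<iota> n g \<alpha>" and A: "bifibrant M A" and X: "bifibrant M X" and C: "bifibrant M C"
    and \<iota>: "\<iota> \<in> hom M A X" and \<kappa>: "\<kappa> \<in> hom M A C" and \<chi>: "\<chi> \<in> hom M X C"
    and \<chi>\<iota>: "homotopic M (\<chi> \<cdot> \<iota>) \<kappa>"
  shows "g \<in> hom M (Dom M g) X \<and> bifibrant M (Dom M g) \<and>
    (\<exists>Q. \<exists>g' \<in> hom M Q C. \<exists>\<alpha>'. \<exists>\<phi> \<in> hom M (Dom M g) Q. bifibrant M Q \<and>
      ganea M \<kappa> n g' \<alpha>' \<and> homotopic M (g' \<cdot> \<phi>) (\<chi> \<cdot> g))"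
  using ga
proof induction
  case ganea_0
  have d: "Dom M \<iota> = A" "Dom M \<kappa> = A" using \<iota> \<kappa> by (auto simp: hom_def)
  have "Id M A \<in> hom M A A" using Id_closed hom_Obj(1)[OF \<iota>] by blast
  moreover have "ganea M \<kappa> 0 \<kappa> (Id M A)" using ganea.ganea_0[of M \<kappa>] d by simp
  moreover have "homotopic M (\<kappa> \<cdot> Id M A) (\<chi> \<cdot> \<iota>)"
    using homotopic_sym[OF \<chi>\<iota>] \<kappa> by (simp add: hom_def)
  ultimately show ?case unfolding d using \<iota> \<kappa> A by blast
next
  case (ganea_Suc i g \<alpha> \<eta> \<beta> c h \<alpha>' \<gamma> l g1)
  then obtain Q g' \<alpha>'' \<phi> where g: "g \<in> hom M (Dom M g) X" and bG: "bifibrant M (Dom M g)"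
    and Q: "bifibrant M Q" and g': "g' \<in> hom M Q C" and \<phi>: "\<phi> \<in> hom M (Dom M g) Q"
    and ga': "ganea M \<kappa> i g' \<alpha>''" and H: "homotopic M (g' \<cdot> \<phi>) (\<chi> \<cdot> g)"
    by blast
  let ?P = "Cod M \<alpha>'"
  have "hsquare M \<eta> \<beta> \<alpha>' \<gamma> c l" "hsquare M \<eta> \<beta> \<iota> g c h"
    using ganea_Suc(2,3) by (simp_all add: hpushout_def hpullback_def)
  then have bP: "bifibrant M ?P" and \<alpha>': "\<alpha>' \<in> hom M A ?P" and \<gamma>: "\<gamma> \<in> hom M (Dom M g) ?P"
    using \<iota> unfolding hsquare_def hom_def by auto
  have d: "Cod M \<iota> = X" "Dom M \<alpha>' = A" "Dom M \<gamma> = Dom M g" using \<iota> \<alpha>' \<gamma> by (auto simp: hom_def)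
  have g1: "g1 \<in> hom M ?P X" using ganea_Suc(4) d by (simp add: whisker_def)
  then have dg1: "Dom M g1 = ?P" by (simp add: hom_def)
  have p: "\<chi> \<cdot> g1 \<in> hom M ?P C" using \<chi> g1 by (auto simp: hom_def)
  note wr = whisker_restrict[OF ganea_Suc(4)]
  have m: "g1 \<cdot> \<alpha>' \<in> hom M A X" "g1 \<cdot> \<gamma> \<in> hom M (Dom M g) X" "(\<chi> \<cdot> g1) \<cdot> \<alpha>' \<in> hom M A C"
    "(\<chi> \<cdot> g1) \<cdot> \<gamma> \<in> hom M (Dom M g) C"
    using g1 \<alpha>' \<gamma> p by (auto simp: hom_def)
  have as: "\<chi> \<cdot> (g1 \<cdot> \<alpha>') = (\<chi> \<cdot> g1) \<cdot> \<alpha>'" "\<chi> \<cdot> (g1 \<cdot> \<gamma>) = (\<chi> \<cdot> g1) \<cdot> \<gamma>"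
    using g1 \<alpha>' \<gamma> \<chi> by (simp_all add: hom_def)
  have "homotopic M ((\<chi> \<cdot> g1) \<cdot> \<alpha>') (\<chi> \<cdot> \<iota>)"
    using homotopic_comp_left[OF wr(1) m(1) \<chi>] as by simp
  then have "homotopic M ((\<chi> \<cdot> g1) \<cdot> \<alpha>') \<kappa>"
    using homotopic_trans[OF bifibrantD(2)[OF A] bifibrantD(1)[OF C] m(3) _ \<chi>\<iota>] by blast
  then have pa: "homotopic M ((\<chi> \<cdot> g1) \<cdot> \<alpha>') (\<kappa> \<cdot> Id M A)" using \<kappa> by (simp add: hom_def)
  have "homotopic M ((\<chi> \<cdot> g1) \<cdot> \<gamma>) (\<chi> \<cdot> g)"
    using homotopic_comp_left[OF wr(2) m(2) \<chi>] as by simp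
  then have pb: "homotopic M ((\<chi> \<cdot> g1) \<cdot> \<gamma>) (g' \<cdot> \<phi>)"
    using homotopic_trans[OF bifibrantD(2)[OF bG] bifibrantD(1)[OF C] m(4) _ homotopic_sym[OF H]]
    by blast
  have "Id M A \<in> hom M (Dom M \<alpha>') A" using Id_closed hom_Obj(1)[OF \<iota>] d by simp
  moreover have "\<phi> \<in> hom M (Dom M \<gamma>) Q" using \<phi> d by simp
  ultimately obtain Q' g'' \<beta>' \<phi>' where "bifibrant M Q'" "g'' \<in> hom M Q' C" "\<phi>' \<in> hom M ?P Q'"
    "ganea M \<kappa> (Suc i) g'' \<beta>'" "homotopic M (g'' \<cdot> \<phi>') (\<chi> \<cdot> g1)"
    using ganea_Suc_map[OF A C Q \<kappa> g' ga' ganea_Suc(3) p _ _ pa pb] by blast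
  then show ?case unfolding dg1 using g1 bP by blast
qed

text \<open>A section \<open>\<sigma>\<close> for \<open>\<iota>X\<close>, followed by the map over \<open>\<chi>\<close>, lifts \<open>\<chi>\<close> through the \<open>n\<close>-th stage for
  \<open>\<iota>C\<close>. Hence the identity of the homotopy pushout \<open>C\<close> lifts through the next stage, and on \<open>A\<close>
  its lift is the canonical map \<open>\<alpha>''\<close>.\<close>

lemma relcat_le_Suc_hpushout:
  assumes A: "bifibrant M A" and X: "bifibrant M X" and C: "bifibrant M C"
    and \<iota>X: "\<iota>X \<in> hom M A X" and \<iota>C: "\<iota>C \<in> hom M A C" and \<chi>: "\<chi> \<in> hom M X C"
    and P: "hpushout M \<rho> f \<iota>C \<chi> c h" and H: "homotopic M (\<chi> \<cdot> \<iota>X) \<iota>C"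
    and n: "relcat_le M \<iota>X n"
  shows "relcat_le M \<iota>C (Suc n)"
proof -
  have d: "Cod M \<iota>X = X" "Cod M \<iota>C = C" "Dom M \<iota>C = A" "Dom M \<chi> = X"
    using \<iota>X \<iota>C \<chi> by (auto simp: hom_def)
  obtain g \<alpha> \<sigma> where ga: "ganea M \<iota>X n g \<alpha>" and \<sigma>: "\<sigma> \<in> hom M X (Dom M g)"
    "homotopic M (g \<cdot> \<sigma>) (Id M X)"
    using n unfolding relcat_le_def d by blast
  obtain Q g' \<alpha>' \<phi> where g: "g \<in> hom M (Dom M g) X" and bG: "bifibrant M (Dom M g)"
    and Q: "bifibrant M Q" and g': "g' \<in> hom M Q C" and \<phi>: "\<phi> \<in> hom M (Dom M g) Q"
    and ga': "ganea M \<iota>C n g' \<alpha>'" and H': "homotopic M (g' \<cdot> \<phi>) (\<chi> \<cdot> g)"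
    using ganea_map[OF ga A X C \<iota>X \<iota>C \<chi> H] by blast
  have b: "\<phi> \<cdot> \<sigma> \<in> hom M X Q" using \<phi> \<sigma> by (auto simp: hom_def)
  have m: "g' \<cdot> \<phi> \<in> hom M (Dom M g) C" "\<chi> \<cdot> g \<in> hom M (Dom M g) C" "g \<cdot> \<sigma> \<in> hom M X X"
    "g' \<cdot> (\<phi> \<cdot> \<sigma>) \<in> hom M X C"
    using g g' \<phi> \<chi> \<sigma>(1) by (auto simp: hom_def)
  have "homotopic M ((g' \<cdot> \<phi>) \<cdot> \<sigma>) ((\<chi> \<cdot> g) \<cdot> \<sigma>)"
    by (rule homotopic_comp_right[OF bifibrantD(2)[OF bG] bifibrantD(1)[OF C] bifibrantD(2)[OF X]
          m(1,2) \<sigma>(1) H'])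
  moreover have "homotopic M (\<chi> \<cdot> (g \<cdot> \<sigma>)) (\<chi> \<cdot> Id M X)"
    by (rule homotopic_comp_left[OF \<sigma>(2) m(3) \<chi>])
  moreover have "(g' \<cdot> \<phi>) \<cdot> \<sigma> = g' \<cdot> (\<phi> \<cdot> \<sigma>)" "(\<chi> \<cdot> g) \<cdot> \<sigma> = \<chi> \<cdot> (g \<cdot> \<sigma>)" "\<chi> \<cdot> Id M X = \<chi>"
    using g g' \<phi> \<chi> \<sigma>(1) by (simp_all add: hom_def)
  ultimately have "homotopic M (g' \<cdot> (\<phi> \<cdot> \<sigma>)) \<chi>"
    using homotopic_trans[OF bifibrantD(2)[OF X] bifibrantD(1)[OF C] m(4)] by simp
  then have pb: "homotopic M (Id M C \<cdot> \<chi>) (g' \<cdot> (\<phi> \<cdot> \<sigma>))"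
    using homotopic_sym \<chi> by (simp add: hom_def)
  have "homotopic M \<iota>C \<iota>C"
    by (rule homotopic_refl[OF bifibrantD(2)[OF A] bifibrantD(1)[OF C] \<iota>C])
  then have pa: "homotopic M (Id M C \<cdot> \<iota>C) (\<iota>C \<cdot> Id M A)" using \<iota>C by (simp add: hom_def)
  have p: "Id M C \<in> hom M (Cod M \<iota>C) C" "Id M A \<in> hom M (Dom M \<iota>C) A" "\<phi> \<cdot> \<sigma> \<in> hom M (Dom M \<chi>) Q"
    using Id_closed hom_Obj[OF \<iota>C] b d by simp_all
  obtain R g'' \<alpha>'' \<psi> where R: "g'' \<in> hom M R C" "\<alpha>'' \<in> hom M A R" "\<psi> \<in> hom M C R"
    "ganea M \<iota>C (Suc n) g'' \<alpha>''" "homotopic M (g'' \<cdot> \<psi>) (Id M C)"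
    "homotopic M (\<psi> \<cdot> \<iota>C) (\<alpha>'' \<cdot> Id M A)"
    using ganea_Suc_map[OF A C Q \<iota>C g' ga' P p pa pb] unfolding d by blast
  have "\<alpha>'' \<cdot> Id M A = \<alpha>''" "Dom M g'' = R" using R by (simp_all add: hom_def)
  then show ?thesis unfolding relcat_le_def d using R by auto
qed

end

lemma relcat_le_add_one:
  assumes "\<And>n. relcat_le M \<iota> n \<Longrightarrow> relcat_le M \<kappa> (Suc n)"
  shows "relcat M \<kappa> \<le> relcat M \<iota> + 1"
proof (cases "relcat M \<iota>")
  case (enat m)
  then have "\<exists>n. relcat_le M \<iota> n" unfolding relcat_def Inf_enat_def by (auto split: if_splits)
  then have "enat m \<in> enat ` {n. relcat_le M \<iota> n}"
    using enat unfolding relcat_def Inf_enat_def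
    by (metis (mono_tags, lifting) LeastI image_eqI image_is_empty empty_Collect_eq mem_Collect_eq)
  then have "relcat_le M \<kappa> (Suc m)" using assms by auto
  then have "relcat M \<kappa> \<le> enat (Suc m)" unfolding relcat_def by (intro Inf_lower) auto
  then show ?thesis using enat by (simp add: one_enat_def)
qed simp

theorem proposition22:
  fixes M :: "('o, 'a, 'x) modcat_scheme"
    and A X Z C :: 'o
    and \<iota>X \<rho> f \<iota>C \<chi> :: 'a
  assumes "closed_model_category M" and "cube_axiom M"
    and "bifibrant M A" and "bifibrant M X" and "bifibrant M Z" and "bifibrant M C"
    and "\<iota>X \<in> hom M A X" and "\<rho> \<in> hom M Z A" and "f \<in> hom M Z X"
    and "\<iota>C \<in> hom M A C" and "\<chi> \<in> hom M X C"
    and "\<exists>c h. hpushout M \<rho> f \<iota>C \<chi> c h"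
    and "homotopic M (\<chi> \<cdot>\<^bsub>M\<^esub> \<iota>X) \<iota>C"
  shows "relcat M \<iota>C \<le> relcat M \<iota>X + 1"
proof (rule relcat_le_add_one)
  fix n
  assume "relcat_le M \<iota>X n"
  then show "relcat_le M \<iota>C (Suc n)"
    using closed_model_category.relcat_le_Suc_hpushout[OF assms(1)] assms by blast
qed

end
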